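(* Let $dx,dy$ be the octonionic coordinate $1$-forms on $\mathbb{O}^2$, and put $$\Psi_{40}:=((\overline{dx}\wedge dx)\wedge\overline{dx})\wedge dx,\qquad \Psi_{31}:=((\overline{dy}\wedge dx)\wedge\overline{dx})\wedge dx,$$ $$\Psi_{13}:=((\overline{dx}\wedge dy)\wedge\overline{dy})\wedge dy,\qquad \Psi_{04}:=((\overline{dy}\wedge dy)\wedge\overline{dy})\wedge dy,$$ $$\Psi_8:=\Psi_{40}\wedge\overline{\Psi_{40}}+4\,\Psi_{31}\wedge\overline{\Psi_{31}}-5\left(\Psi_{31}\wedge\Psi_{13}+\overline{\Psi_{13}}\wedge\overline{\Psi_{31}}\right)+4\,\Psi_{13}\wedge\overline{\Psi_{13}}+\Psi_{04}\wedge\overline{\Psi_{04}}.$$ Then the expansion of the form $-\frac{1}{4\cdot 6!}\Psi_8$ in the standard basis of $\bigwedge^8(\mathbb{O}^2)^*$ (the wedge monomials in $dx^0,\dots,dx^7,dy^0,\dots,dy^7$, considered up to sign) has exactly $702$ non-trivial terms, namely the following (indices $i_k\in\{0,\dots,7\}$ with $i_k\ne i_l$ for $k\neq l$ within each item; wedge symbols omitted): 1. $dx^0\cdots dx^7$ with coefficient $-14$ ($1$ term); 2. $dx^{i_0}\cdots dx^{i_5}dy^{i_6}dy^{i_7}$ with $i_0<\cdots<i_5$, $i_6<i_7$, with coefficients $\pm2$ ($28$ terms); 3. $dx^{i_0}\cdots dx^{i_5}dy^{i_4}dy^{i_5}$ with $i_0<\cdots<i_3$, $i_4<i_5$, $i_0i_1i_2i_3=0$,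 with coefficients $\pm2$ ($84$ terms); 4. $dx^{i_0}\cdots dx^{i_3}dy^{i_4}\cdots dy^{i_7}$ with $i_0<\cdots<i_3$, $i_4<\cdots<i_7$, $i_0i_1i_2i_3=0$, with coefficients $\pm2$ ($14$ terms); 5. $dx^{i_0}\cdots dx^{i_3}dy^{i_4}\cdots dy^{i_7}$ with $i_0<\cdots<i_3$, $i_4<\cdots<i_7$, $i_0i_1i_2i_3\neq0$, with coefficients $\pm1$ ($56$ terms); 6. $dx^{i_0}\cdots dx^{i_3}dy^{i_2}\cdots dy^{i_5}$ with $i_0<i_1$, $i_2<i_3$, $i_0i_1i_2i_3\neq0$, $i_4=i_0i_2i_3$, $i_5=i_1i_2i_3$, with coefficients $\pm1$ ($336$ terms); 7. $dx^{i_0}\cdots dx^{i_3}dy^{i_0}\cdots dy^{i_3}$ with $i_0<\cdots<i_3$, $i_0i_1i_2i_3\neq0$, with coefficients $\pm1$ ($56$ terms); 8. $dx^{i_0}\cdots dx^{i_3}dy^{i_0}\cdots dy^{i_3}$ with $i_0<\cdots<i_3$, $i_0i_1i_2i_3=0$, with coefficients $\pm2$ ($14$ terms); 9. $dx^{i_0}dx^{i_1}dy^{i_0}\cdots dy^{i_5}$ with $i_0<i_1$, $i_2<\cdots<i_5$, $i_2i_3i_4i_5=0$, with coefficients $\pm2$ ($84$ terms); 10. $dx^{i_0}dx^{i_1}dy^{i_2}\cdots dy^{i_7}$ with $i_0<i_1$, $i_2<\cdots<i_7$, with coefficients $\pm2$ ($28$ terms); 11. $dy^0\cdots dy^7$ with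 coefficient $-14$ ($1$ term). Here "$\pm c$" means that each term of the class has coefficient either $c$ or $-c$ (the sign depending on the term).
   Context: Octonions: $\mathbb{O}=\mathbb{R}^8$ with standard basis $e_0=1,e_1,\dots,e_7$; it is the alternative (non-associative) unital real algebra with $e_i^2=-1$, $e_ie_j=-e_je_i$ for $i\neq j$ in $\{1,\dots,7\}$, and $e_{1+i}e_{2+i}=e_{4+i}$ for $1\le i\le 7$, with indices reduced modulo $7$ to $\{1,\dots,7\}$. The involution is $\overline{1}=1$, $\overline{e_j}=-e_j$. Product of indices: for $i,j\in\{0,\dots,7\}$, $ij$ denotes the unique element of $\{0,\dots,7\}$ such that $e_{ij}=\pm e_ie_j$. This product is commutative and associative. Octonion-valued forms: for a finite-dimensional real vector space $V$, $\mathbb{O}\otimes\bigwedge^\bullet V^*$ (tensor product over $\mathbb{R}$) carries the (non-associative) product $(u\otimes\varphi)\wedge(v\otimes\psi):=(uv)\otimes(\varphi\wedge\psi)$ and the involution $\overline{u\otimes\varphi}=\overline u\otimes\varphi$. Real forms are identified with elements of $\mathbb{R}1\otimes\bigwedge^\bullet V^*$. For $V=\mathbb{O}^2$, $dx\binom{u_1}{u_2}=u_1$ and $dy\binom{u_1}{u_2}=u_2$, i.e. $dx=\sum_{i=0}^7e_i\otimes dx^i$, $dy=\sum_{i=0}^7e_i\otimes dy^i$, where $dx^0,\dots,dx^7,dy^0,\dots,dy^7$ is the basis of $V^*$ dual to the standard basis of $\mathbb{O}^2=\mathbb{O}\oplus\mathbb{O}$. *)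

theory Defs
  imports "HOL-Analysis.Analysis"
begin

section \<open>Octonions\<close>

text \<open>
  The index type \<^typ>\<open>8\<close> consists of the residues 0, ..., 7, ordered in this way.  Its ring
  multiplication is not the product of indices used below, which is written \<open>\<odot>\<close>.
\<close>

type_synonym octonion = "real ^ 8"

definition e :: "8 \<Rightarrow> octonion" where
  "e i = axis i 1"

text \<open>
  The triples (1+i, 2+i, 4+i), i = 1, ..., 7, with entries reduced modulo 7 to 1, ..., 7.  In an
  alternative algebra with \<open>e i e i = -1\<close> and \<open>e i e j = - e j e i\<close>, the rule
  \<open>e a e b = e c\<close> forces \<open>e b e c = e a\<close> and \<open>e c e a = e b\<close>, hence the cyclic closure.
\<close>

definition oct_triples :: "(8 \<times> 8 \<times> 8) set" where
  "oct_triples = {(2,3,5), (3,4,6), (4,5,7), (5,6,1), (6,7,2), (7,1,3), (1,2,4)}"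

definition oct_pos :: "8 \<Rightarrow> 8 \<Rightarrow> 8 \<Rightarrow> bool" where
  "oct_pos i j k \<longleftrightarrow>
     (i, j, k) \<in> oct_triples \<or> (j, k, i) \<in> oct_triples \<or> (k, i, j) \<in> oct_triples"

text \<open>The coefficient of \<open>e k\<close> in \<open>e i e j\<close>.\<close>

definition oct_coeff :: "8 \<Rightarrow> 8 \<Rightarrow> 8 \<Rightarrow> real" where
  "oct_coeff i j k =
     (if i = 0 then of_bool (j = k)
      else if j = 0 then of_bool (i = k)
      else if i = j then - of_bool (k = 0)
      else if oct_pos i j k then 1
      else if oct_pos j i k then -1
      else 0)"

definition oct_mult :: "octonion \<Rightarrow> octonion \<Rightarrow> octonion" (infixl "\<bullet>\<^sub>O" 70) where
  "x \<bullet>\<^sub>O y = (\<chi> k. \<Sum>i\<in>UNIV. \<Sum>j\<in>UNIV. oct_coeff i j k * x $ i * y $ j)"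

definition oct_cnj :: "octonion \<Rightarrow> octonion" where
  "oct_cnj x = (\<chi> i. if i = 0 then x $ i else - x $ i)"

definition index_mult :: "8 \<Rightarrow> 8 \<Rightarrow> 8" (infixl "\<odot>" 70) where
  "i \<odot> j = (THE k. e k = e i \<bullet>\<^sub>O e j \<or> e k = - (e i \<bullet>\<^sub>O e j))"


lemma UNIV_8: "(UNIV :: 8 set) = {0, 1, 2, 3, 4, 5, 6, 7}"
proof -
  have "card {0, 1, 2, 3, 4, 5, 6, 7 :: 8} = CARD(8)" by simp
  then show ?thesis by (metis card_subset_eq finite subset_UNIV)
qed

lemma sum_8: "sum f (UNIV :: 8 set) = f 0 + f 1 + f 2 + f 3 + f 4 + f 5 + f 6 + f 7"
  for f :: "8 \<Rightarrow> 'a::comm_monoid_add"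
  unfolding UNIV_8 by (simp add: ac_simps)

lemma forall_8: "(\<forall>i::8. P i) \<longleftrightarrow> P 0 \<and> P 1 \<and> P 2 \<and> P 3 \<and> P 4 \<and> P 5 \<and> P 6 \<and> P 7"
  by (metis (full_types) UNIV_8 UNIV_I insert_iff empty_iff)

lemma neq_8:
  "(0::8) \<noteq> 1" "(0::8) \<noteq> 2" "(0::8) \<noteq> 3" "(0::8) \<noteq> 4" "(0::8) \<noteq> 5" "(0::8) \<noteq> 6" "(0::8) \<noteq> 7"
  "(1::8) \<noteq> 0" "(1::8) \<noteq> 2" "(1::8) \<noteq> 3" "(1::8) \<noteq> 4" "(1::8) \<noteq> 5" "(1::8) \<noteq> 6" "(1::8) \<noteq> 7"
  "(2::8) \<noteq> 0" "(2::8) \<noteq> 1" "(2::8) \<noteq> 3" "(2::8) \<noteq> 4" "(2::8) \<noteq> 5" "(2::8) \<noteq> 6" "(2::8) \<noteq> 7"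
  "(3::8) \<noteq> 0" "(3::8) \<noteq> 1" "(3::8) \<noteq> 2" "(3::8) \<noteq> 4" "(3::8) \<noteq> 5" "(3::8) \<noteq> 6" "(3::8) \<noteq> 7"
  "(4::8) \<noteq> 0" "(4::8) \<noteq> 1" "(4::8) \<noteq> 2" "(4::8) \<noteq> 3" "(4::8) \<noteq> 5" "(4::8) \<noteq> 6" "(4::8) \<noteq> 7"
  "(5::8) \<noteq> 0" "(5::8) \<noteq> 1" "(5::8) \<noteq> 2" "(5::8) \<noteq> 3" "(5::8) \<noteq> 4" "(5::8) \<noteq> 6" "(5::8) \<noteq> 7"
  "(6::8) \<noteq> 0" "(6::8) \<noteq> 1" "(6::8) \<noteq> 2" "(6::8) \<noteq> 3" "(6::8) \<noteq> 4" "(6::8) \<noteq> 5" "(6::8) \<noteq> 7"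
  "(7::8) \<noteq> 0" "(7::8) \<noteq> 1" "(7::8) \<noteq> 2" "(7::8) \<noteq> 3" "(7::8) \<noteq> 4" "(7::8) \<noteq> 5" "(7::8) \<noteq> 6"
  by simp_all

lemmas oct_eval = oct_coeff_def oct_pos_def oct_triples_def neq_8 simp_thms if_True if_False
  insert_iff empty_iff prod.inject of_bool_eq

lemma e_nth: "e i $ k = of_bool (k = i)"
  by (simp add: e_def axis_def)

lemma oct_mult_e_nth: "(e i \<bullet>\<^sub>O e j) $ k = oct_coeff i j k"
  by (simp add: oct_mult_def e_def axis_def if_distrib[of "\<lambda>x. _ * x"]
      if_distrib[of "\<lambda>x. x * _"] cong: if_cong)

lemma oct_mult_nth:
  fixes x y :: octonion
  shows
  "(x \<bullet>\<^sub>O y) $ 0 = x$0*y$0 - x$1*y$1 - x$2*y$2 - x$3*y$3 - x$4*y$4 - x$5*y$5 - x$6*y$6 - x$7*y$7"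
  "(x \<bullet>\<^sub>O y) $ 1 = x$0*y$1 + x$1*y$0 + x$2*y$4 - x$4*y$2 + x$3*y$7 - x$7*y$3 + x$5*y$6 - x$6*y$5"
  "(x \<bullet>\<^sub>O y) $ 2 = x$0*y$2 + x$2*y$0 + x$3*y$5 - x$5*y$3 + x$4*y$1 - x$1*y$4 + x$6*y$7 - x$7*y$6"
  "(x \<bullet>\<^sub>O y) $ 3 = x$0*y$3 + x$3*y$0 + x$4*y$6 - x$6*y$4 + x$5*y$2 - x$2*y$5 + x$7*y$1 - x$1*y$7"
  "(x \<bullet>\<^sub>O y) $ 4 = x$0*y$4 + x$4*y$0 + x$5*y$7 - x$7*y$5 + x$6*y$3 - x$3*y$6 + x$1*y$2 - x$2*y$1"
  "(x \<bullet>\<^sub>O y) $ 5 = x$0*y$5 + x$5*y$0 + x$6*y$1 - x$1*y$6 + x$7*y$4 - x$4*y$7 + x$2*y$3 - x$3*y$2"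
  "(x \<bullet>\<^sub>O y) $ 6 = x$0*y$6 + x$6*y$0 + x$7*y$2 - x$2*y$7 + x$1*y$5 - x$5*y$1 + x$3*y$4 - x$4*y$3"
  "(x \<bullet>\<^sub>O y) $ 7 = x$0*y$7 + x$7*y$0 + x$1*y$3 - x$3*y$1 + x$2*y$6 - x$6*y$2 + x$4*y$5 - x$5*y$4"
  by (simp_all only: oct_mult_def sum_8 oct_eval vec_lambda_beta
      mult_1_left mult_zero_left add_0_left add_0_right mult_minus1)

lemma oct_mult_alternative:
  "x \<bullet>\<^sub>O (x \<bullet>\<^sub>O y) = (x \<bullet>\<^sub>O x) \<bullet>\<^sub>O y"
  "(y \<bullet>\<^sub>O x) \<bullet>\<^sub>O x = y \<bullet>\<^sub>O (x \<bullet>\<^sub>O x)"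
  by (simp_all add: vec_eq_iff forall_8 oct_mult_nth algebra_simps)

lemma oct_mult_one: "e 0 \<bullet>\<^sub>O x = x" "x \<bullet>\<^sub>O e 0 = x"
  by (simp_all add: vec_eq_iff forall_8 oct_mult_nth e_def axis_def)

lemma e_square: "i \<noteq> 0 \<Longrightarrow> e i \<bullet>\<^sub>O e i = - e 0"
  unfolding vec_eq_iff oct_mult_e_nth by (simp add: oct_coeff_def e_def axis_def)

lemma e_anticommute: "i \<noteq> 0 \<Longrightarrow> j \<noteq> 0 \<Longrightarrow> i \<noteq> j \<Longrightarrow> e i \<bullet>\<^sub>O e j = - (e j \<bullet>\<^sub>O e i)"
proof -
  have "\<forall>i j k. \<not> (oct_pos i j k \<and> oct_pos j i k)"
    by (simp only: forall_8 oct_eval)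
  then show "i \<noteq> 0 \<Longrightarrow> j \<noteq> 0 \<Longrightarrow> i \<noteq> j \<Longrightarrow> e i \<bullet>\<^sub>O e j = - (e j \<bullet>\<^sub>O e i)"
    by (auto simp: vec_eq_iff oct_mult_e_nth oct_coeff_def)
qed

lemma e_triple:
  assumes "n \<in> {1..7::nat}" and "r = (\<lambda>m. of_nat ((m - 1) mod 7 + 1))"
  shows "e (r (1 + n)) \<bullet>\<^sub>O e (r (2 + n)) = e (r (4 + n))"
proof -
  have "n = 1 \<or> n = 2 \<or> n = 3 \<or> n = 4 \<or> n = 5 \<or> n = 6 \<or> n = 7"
    using assms(1) by auto
  then show ?thesis
    by (elim disjE)
      (simp_all add: assms(2) vec_eq_iff forall_8 oct_mult_e_nth,
       simp_all add: oct_eval e_def axis_def)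
qed

lemma e_eq_iff: "e i = e j \<longleftrightarrow> i = j"
  by (simp add: e_def axis_eq_axis)

lemma index_mult_ex1: "\<exists>!k. e k = e i \<bullet>\<^sub>O e j \<or> e k = - (e i \<bullet>\<^sub>O e j)"
proof -
  have "\<forall>i j. (\<Sum>l\<in>UNIV. \<bar>oct_coeff i j l\<bar>) = 1"
    by (simp only: forall_8 sum_8 oct_eval abs_one abs_zero abs_minus_cancel minus_zero
        add_0_left add_0_right)
  moreover have "(\<Sum>l\<in>UNIV. \<bar>oct_coeff i j l\<bar>) = (\<Sum>l\<in>UNIV. of_bool (oct_coeff i j l \<noteq> 0))"
    by (rule sum.cong) (simp_all add: oct_coeff_def)
  ultimately have "card {l. oct_coeff i j l \<noteq> 0} = 1" by simp
  then obtain k where k: "{l. oct_coeff i j l \<noteq> 0} = {k}" by (rule card_1_singletonE)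
  have zero: "oct_coeff i j l = 0" if "l \<noteq> k" for l
    using k that by auto
  have "oct_coeff i j k \<noteq> 0" using k by blast
  then have "oct_coeff i j k = 1 \<or> oct_coeff i j k = -1"
    by (auto simp: oct_coeff_def split: if_splits)
  then have "e k = e i \<bullet>\<^sub>O e j \<or> e k = - (e i \<bullet>\<^sub>O e j)"
    using zero by (simp add: vec_eq_iff oct_mult_e_nth e_nth)
  moreover have "l = k" if "e l = e i \<bullet>\<^sub>O e j \<or> e l = - (e i \<bullet>\<^sub>O e j)" for l
  proof -
    have "\<bar>e l $ l\<bar> = \<bar>oct_coeff i j l\<bar>"
      using that by (auto simp flip: oct_mult_e_nth)
    then show ?thesis using zero[of l] by (cases "l = k") (auto simp: e_nth)
  qed
  ultimately show ?thesis by blast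
qed

lemma index_mult_eq: "e k = e i \<bullet>\<^sub>O e j \<or> e k = - (e i \<bullet>\<^sub>O e j) \<Longrightarrow> i \<odot> j = k"
  unfolding index_mult_def using index_mult_ex1 by (rule the1_equality)


section \<open>Forms with values in a real algebra\<close>

text \<open>
  Let \<open>V\<close> have a basis indexed by the finite linearly ordered type \<open>'n\<close>.  The standard basis of
  the exterior algebra of the dual space consists of the increasing wedge monomials, which are in
  bijection with the subsets of \<open>'n\<close>.  An \<open>'a\<close>-valued form, i.e. an element of the tensor product of
  \<open>'a\<close> with the exterior algebra, is given by its coefficients with respect to this basis.
\<close>

type_synonym ('a, 'n) form = "('a, 'n set) vec"

text \<open>
  The sign in \<open>dx\<^sub>T \<and> dx\<^sub>U = \<plusminus> dx\<^sub>T\<^sub>\<union>\<^sub>U\<close> for disjoint \<open>T\<close> and \<open>U\<close>.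
\<close>

definition wedge_sign :: "'n::{finite,linorder} set \<Rightarrow> 'n set \<Rightarrow> real" where
  "wedge_sign T U = (-1) ^ card {(i, j). i \<in> T \<and> j \<in> U \<and> j < i}"

text \<open>The wedge product based on an arbitrary bilinear product of the coefficients.\<close>

definition wedge_by ::
  "('a \<Rightarrow> 'a \<Rightarrow> 'a) \<Rightarrow> ('a::real_vector, 'n::{finite,linorder}) form \<Rightarrow> ('a, 'n) form \<Rightarrow> ('a, 'n) form"
where
  "wedge_by mul F G = (\<chi> S. \<Sum>T\<in>Pow S. wedge_sign T (S - T) *\<^sub>R mul (F $ T) (G $ (S - T)))"

abbreviation wedge ::
  "(real, 'n::{finite,linorder}) form \<Rightarrow> (real, 'n) form \<Rightarrow> (real, 'n) form"  (infixl "\<and>\<^sub>R" 70)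
where
  "\<phi> \<and>\<^sub>R \<psi> \<equiv> wedge_by (*) \<phi> \<psi>"

abbreviation oct_wedge ::
  "(octonion, 'n::{finite,linorder}) form \<Rightarrow> (octonion, 'n) form \<Rightarrow> (octonion, 'n) form"
  (infixl "\<and>\<^sub>O" 70)
where
  "F \<and>\<^sub>O G \<equiv> wedge_by (\<bullet>\<^sub>O) F G"

definition tensor :: "'a::real_vector \<Rightarrow> (real, 'n::finite) form \<Rightarrow> ('a, 'n) form" (infix "\<otimes>" 75) where
  "u \<otimes> \<phi> = (\<chi> S. (\<phi> $ S) *\<^sub>R u)"

definition form_cnj :: "(octonion, 'n::finite) form \<Rightarrow> (octonion, 'n) form" where
  "form_cnj F = (\<chi> S. oct_cnj (F $ S))"

definition real_form :: "(real, 'n::finite) form \<Rightarrow> (octonion, 'n) form" where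
  "real_form \<phi> = e 0 \<otimes> \<phi>"

definition form_one :: "(real, 'n::finite) form" where
  "form_one = axis {} 1"

text \<open>The element of the dual basis with index \<open>i\<close>.\<close>

definition coord_form :: "'n::finite \<Rightarrow> (real, 'n) form" where
  "coord_form i = axis {i} 1"

definition wedge_list :: "'n::{finite,linorder} list \<Rightarrow> (real, 'n) form" where
  "wedge_list is = foldr (\<lambda>i \<phi>. coord_form i \<and>\<^sub>R \<phi>) is form_one"


text \<open>
  The following facts characterise the exterior algebra and the product on the tensor product.
\<close>

lemma wedge_by_nth:
  "wedge_by mul F G $ S = (\<Sum>T\<in>Pow S. wedge_sign T (S - T) *\<^sub>R mul (F $ T) (G $ (S - T)))"
  by (simp add: wedge_by_def)

lemma wedge_sign_Un_left:
  assumes "T \<inter> U = {}"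
  shows "wedge_sign (T \<union> U) W = wedge_sign T W * wedge_sign U W"
proof -
  have "{(i, j). i \<in> T \<union> U \<and> j \<in> W \<and> j < i} =
    {(i, j). i \<in> T \<and> j \<in> W \<and> j < i} \<union> {(i, j). i \<in> U \<and> j \<in> W \<and> j < i}" by auto
  moreover have "{(i, j). i \<in> T \<and> j \<in> W \<and> j < i} \<inter> {(i, j). i \<in> U \<and> j \<in> W \<and> j < i} = {}"
    using assms by auto
  ultimately show ?thesis
    by (simp add: wedge_sign_def card_Un_disjoint power_add)
qed

lemma wedge_sign_Un_right:
  assumes "U \<inter> W = {}"
  shows "wedge_sign T (U \<union> W) = wedge_sign T U * wedge_sign T W"
proof -
  have "{(i, j). i \<in> T \<and> j \<in> U \<union> W \<and> j < i} =
    {(i, j). i \<in> T \<and> j \<in> U \<and> j < i} \<union> {(i, j). i \<in> T \<and> j \<in> W \<and> j < i}" by auto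
  moreover have "{(i, j). i \<in> T \<and> j \<in> U \<and> j < i} \<inter> {(i, j). i \<in> T \<and> j \<in> W \<and> j < i} = {}"
    using assms by auto
  ultimately show ?thesis
    by (simp add: wedge_sign_def card_Un_disjoint power_add)
qed

lemma wedge_assoc: "(\<phi> \<and>\<^sub>R \<psi>) \<and>\<^sub>R \<omega> = \<phi> \<and>\<^sub>R (\<psi> \<and>\<^sub>R \<omega>)"
proof -
  have "((\<phi> \<and>\<^sub>R \<psi>) \<and>\<^sub>R \<omega>) $ S = (\<phi> \<and>\<^sub>R (\<psi> \<and>\<^sub>R \<omega>)) $ S" for S
  proof -
    have "((\<phi> \<and>\<^sub>R \<psi>) \<and>\<^sub>R \<omega>) $ S = (\<Sum>T\<in>Pow S. \<Sum>U\<in>Pow T.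
        wedge_sign T (S - T) * (wedge_sign U (T - U) * (\<phi> $ U * \<psi> $ (T - U))) * \<omega> $ (S - T))"
      by (simp add: wedge_by_nth sum_distrib_left sum_distrib_right mult.assoc)
    also have "\<dots> = (\<Sum>(T, U)\<in>(SIGMA T:Pow S. Pow T).
        wedge_sign T (S - T) * (wedge_sign U (T - U) * (\<phi> $ U * \<psi> $ (T - U))) * \<omega> $ (S - T))"
      by (subst sum.Sigma) auto
    also have "\<dots> = (\<Sum>(U, V)\<in>(SIGMA U:Pow S. Pow (S - U)).
        wedge_sign U (S - U) * (\<phi> $ U * (wedge_sign V (S - U - V) * (\<psi> $ V * \<omega> $ (S - U - V)))))"
    proof (rule sum.reindex_bij_witness[where
          i = "\<lambda>(U, V). (U \<union> V, U)" and j = "\<lambda>(T, U). (U, T - U)"], goal_cases)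
      case (5 p)
      obtain T U where p: "p = (T, U)" by (cases p)
      with 5 have TU: "T \<subseteq> S" "U \<subseteq> T" by auto
      have 1: "S - U - (T - U) = S - T" using TU by auto
      have 2: "wedge_sign T (S - T) = wedge_sign U (S - T) * wedge_sign (T - U) (S - T)"
        using wedge_sign_Un_left[of U "T - U" "S - T"] TU by (simp add: Un_absorb1)
      have "S - U = (T - U) \<union> (S - T)" using TU by auto
      then have 3: "wedge_sign U (S - U) = wedge_sign U (T - U) * wedge_sign U (S - T)"
        using wedge_sign_Un_right[of "T - U" "S - T" U] TU by auto
      show ?case unfolding p prod.case 1 2 3 by (simp add: mult_ac)
    qed auto
    also have "\<dots> = (\<phi> \<and>\<^sub>R (\<psi> \<and>\<^sub>R \<omega>)) $ S"
      by (subst sum.Sigma[symmetric]) (auto simp: wedge_by_nth sum_distrib_left mult.assoc)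
    finally show ?thesis .
  qed
  then show ?thesis by (simp add: vec_eq_iff)
qed

lemma wedge_sign_empty: "wedge_sign {} U = 1" "wedge_sign T {} = 1"
  by (simp_all add: wedge_sign_def)

lemma wedge_axis:
  "axis T 1 \<and>\<^sub>R axis U 1 = (if T \<inter> U = {} then wedge_sign T U *\<^sub>R axis (T \<union> U) 1 else 0)"
proof -
  have "(axis T 1 \<and>\<^sub>R axis U 1) $ S =
      (\<Sum>A\<in>Pow S. if A = T then wedge_sign T (S - T) * of_bool (S - T = U) else 0)" for S
    unfolding wedge_by_nth by (rule sum.cong) (auto simp: axis_def)
  then have "(axis T 1 \<and>\<^sub>R axis U 1) $ S =
      of_bool (T \<subseteq> S) * (wedge_sign T (S - T) * of_bool (S - T = U))" for S
    by simp
  moreover have "T \<subseteq> S \<and> S - T = U \<longleftrightarrow> S = T \<union> U \<and> T \<inter> U = {}" for S by blast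
  ultimately show ?thesis
    by (auto simp: vec_eq_iff axis_def)
qed

lemma wedge_form_one: "form_one \<and>\<^sub>R \<phi> = \<phi>" "\<phi> \<and>\<^sub>R form_one = \<phi>"
proof -
  have "(form_one \<and>\<^sub>R \<phi>) $ S = (\<Sum>A\<in>Pow S. if A = {} then \<phi> $ S else 0)" for S
    unfolding wedge_by_nth
    by (rule sum.cong) (auto simp: axis_def form_one_def wedge_sign_empty)
  then show "form_one \<and>\<^sub>R \<phi> = \<phi>" by (simp add: vec_eq_iff)
  have "(\<phi> \<and>\<^sub>R form_one) $ S = (\<Sum>A\<in>Pow S. if A = S then \<phi> $ S else 0)" for S
    unfolding wedge_by_nth
    by (rule sum.cong) (auto simp: axis_def form_one_def wedge_sign_empty)
  then show "\<phi> \<and>\<^sub>R form_one = \<phi>" by (simp add: vec_eq_iff)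
qed

lemma coord_form_anticommute: "coord_form i \<and>\<^sub>R coord_form j = - (coord_form j \<and>\<^sub>R coord_form i)"
proof (cases "i = j")
  case False
  then have "{(k, l). k \<in> {i} \<and> l \<in> {j} \<and> l < k} = (if j < i then {(i, j)} else {})"
    and "{(k, l). k \<in> {j} \<and> l \<in> {i} \<and> l < k} = (if i < j then {(j, i)} else {})"
    by auto
  then have "wedge_sign {i} {j} = - wedge_sign {j} {i}"
    unfolding wedge_sign_def using False by (cases i j rule: linorder_cases) auto
  then show ?thesis by (simp add: coord_form_def wedge_axis insert_commute)
qed (simp add: coord_form_def wedge_axis)

lemma wedge_list_sorted: "sorted_wrt (<) is \<Longrightarrow> wedge_list is = axis (set is) 1"
proof (induction "is")
  case (Cons i "is")
  have none: "{(k, l). k \<in> {i} \<and> l \<in> set is \<and> l < k} = {}" using Cons.prems by auto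
  have "wedge_sign {i} (set is) = 1" by (simp only: wedge_sign_def none card.empty power_0)
  moreover have "i \<notin> set is" using Cons.prems by auto
  ultimately show ?case using Cons
    by (simp add: wedge_list_def coord_form_def wedge_axis)
qed (simp add: wedge_list_def form_one_def)

lemma oct_wedge_tensor: "(u \<otimes> \<phi>) \<and>\<^sub>O (v \<otimes> \<psi>) = (u \<bullet>\<^sub>O v) \<otimes> (\<phi> \<and>\<^sub>R \<psi>)"
proof -
  have "(a *\<^sub>R u) \<bullet>\<^sub>O (b *\<^sub>R v) = (a * b) *\<^sub>R (u \<bullet>\<^sub>O v)" for a b
    by (simp add: oct_mult_def vec_eq_iff sum_distrib_left mult_ac)
  then show ?thesis
    by (simp add: vec_eq_iff wedge_by_nth tensor_def sum_distrib_left mult_ac)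
qed

lemma oct_wedge_add:
  "(F + G) \<and>\<^sub>O H = F \<and>\<^sub>O H + G \<and>\<^sub>O H" "H \<and>\<^sub>O (F + G) = H \<and>\<^sub>O F + H \<and>\<^sub>O G"
proof -
  have "(x + y) \<bullet>\<^sub>O z = x \<bullet>\<^sub>O z + y \<bullet>\<^sub>O z" "z \<bullet>\<^sub>O (x + y) = z \<bullet>\<^sub>O x + z \<bullet>\<^sub>O y" for x y z
    by (simp_all add: oct_mult_def vec_eq_iff algebra_simps sum.distrib)
  then show "(F + G) \<and>\<^sub>O H = F \<and>\<^sub>O H + G \<and>\<^sub>O H" "H \<and>\<^sub>O (F + G) = H \<and>\<^sub>O F + H \<and>\<^sub>O G"
    by (simp_all add: vec_eq_iff wedge_by_nth algebra_simps sum.distrib)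
qed

lemma form_cnj_tensor: "form_cnj (u \<otimes> \<phi>) = oct_cnj u \<otimes> \<phi>"
  by (simp add: form_cnj_def tensor_def oct_cnj_def vec_eq_iff)


section \<open>The octonionic plane\<close>

text \<open>
  The indices of the standard basis of the octonionic plane, \<open>DX i\<close> in the first and \<open>DY i\<close> in
  the second summand.
\<close>

datatype coord = DX 8 | DY 8

instantiation coord :: linorder
begin

fun less_eq_coord :: "coord \<Rightarrow> coord \<Rightarrow> bool" where
  "DX i \<le> DX j \<longleftrightarrow> i \<le> j"
| "DX i \<le> DY j \<longleftrightarrow> True"
| "DY i \<le> DX j \<longleftrightarrow> False"
| "DY i \<le> DY j \<longleftrightarrow> i \<le> j"

definition less_coord :: "coord \<Rightarrow> coord \<Rightarrow> bool" where
  "less_coord p q \<longleftrightarrow> p \<le> q \<and> \<not> q \<le> p"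

instance
proof
  fix p q r :: coord
  show "p < q \<longleftrightarrow> p \<le> q \<and> \<not> q \<le> p" by (rule less_coord_def)
  show "p \<le> p" by (cases p) auto
  show "p \<le> q \<Longrightarrow> q \<le> r \<Longrightarrow> p \<le> r" by (cases p; cases q; cases r) auto
  show "p \<le> q \<Longrightarrow> q \<le> p \<Longrightarrow> p = q" by (cases p; cases q) auto
  show "p \<le> q \<or> q \<le> p" by (cases p; cases q) auto
qed

end

lemma UNIV_coord: "UNIV = range DX \<union> range DY"
proof -
  have "p \<in> range DX \<union> range DY" for p by (cases p) auto
  then show ?thesis by blast
qed

instance coord :: finite
  by standard (simp add: UNIV_coord)

definition dx :: "(octonion, coord) form" where
  "dx = (\<Sum>i\<in>UNIV. e i \<otimes> coord_form (DX i))"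

definition dy :: "(octonion, coord) form" where
  "dy = (\<Sum>i\<in>UNIV. e i \<otimes> coord_form (DY i))"

definition Psi40 :: "(octonion, coord) form" where
  "Psi40 = ((form_cnj dx \<and>\<^sub>O dx) \<and>\<^sub>O form_cnj dx) \<and>\<^sub>O dx"

definition Psi31 :: "(octonion, coord) form" where
  "Psi31 = ((form_cnj dy \<and>\<^sub>O dx) \<and>\<^sub>O form_cnj dx) \<and>\<^sub>O dx"

definition Psi13 :: "(octonion, coord) form" where
  "Psi13 = ((form_cnj dx \<and>\<^sub>O dy) \<and>\<^sub>O form_cnj dy) \<and>\<^sub>O dy"

definition Psi04 :: "(octonion, coord) form" where
  "Psi04 = ((form_cnj dy \<and>\<^sub>O dy) \<and>\<^sub>O form_cnj dy) \<and>\<^sub>O dy"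

definition Psi8 :: "(octonion, coord) form" where
  "Psi8 = Psi40 \<and>\<^sub>O form_cnj Psi40
        + 4 *\<^sub>R (Psi31 \<and>\<^sub>O form_cnj Psi31)
        - 5 *\<^sub>R (Psi31 \<and>\<^sub>O Psi13 + form_cnj Psi13 \<and>\<^sub>O form_cnj Psi31)
        + 4 *\<^sub>R (Psi13 \<and>\<^sub>O form_cnj Psi13)
        + Psi04 \<and>\<^sub>O form_cnj Psi04"

text \<open>
  The wedge monomial \<open>dx^A dy^B\<close>, with the indices in each of \<open>A\<close> and \<open>B\<close> in increasing order.  Up
  to sign, each non-zero wedge monomial in the \<open>dx^i\<close> and \<open>dy^i\<close> is given by exactly one such pair.
\<close>

definition monomial :: "8 set \<times> 8 set \<Rightarrow> (real, coord) form" where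
  "monomial = (\<lambda>(A, B).
     wedge_list (map DX (sorted_list_of_set A) @ map DY (sorted_list_of_set B)))"

lemma less_coord_simps:
  "DX i < DX j \<longleftrightarrow> i < j" "DX i < DY j" "\<not> DY i < DX j" "DY i < DY j \<longleftrightarrow> i < j"
  by (simp_all only: less_coord_def less_eq_coord.simps less_le_not_le simp_thms)

lemma monomial_eq: "monomial (A, B) = axis (DX ` A \<union> DY ` B) 1"
proof -
  have "sorted_wrt (<) (map DX (sorted_list_of_set A))"
    unfolding sorted_wrt_map less_coord_simps by (rule strict_sorted_list_of_set)
  moreover have "sorted_wrt (<) (map DY (sorted_list_of_set B))"
    unfolding sorted_wrt_map less_coord_simps by (rule strict_sorted_list_of_set)
  ultimately have sorted:
    "sorted_wrt (<) (map DX (sorted_list_of_set A) @ map DY (sorted_list_of_set B))"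
    unfolding sorted_wrt_append by (auto simp: less_coord_simps)
  show ?thesis
    by (simp only: monomial_def prod.case wedge_list_sorted[OF sorted] set_append set_map
        set_sorted_list_of_set[OF finite])
qed

lemma form_expansion: "\<phi> = (\<Sum>(A, B)\<in>UNIV. (\<phi> $ (DX ` A \<union> DY ` B)) *\<^sub>R monomial (A, B))"
proof -
  have "(DX ` (DX -` S) \<union> DY ` (DY -` S)) = S" for S
    using UNIV_coord by auto
  then have bij: "bij_betw (\<lambda>p. DX ` fst p \<union> DY ` snd p) UNIV (UNIV :: coord set set)"
    by (intro bij_betw_byWitness[where f' = "\<lambda>S. (DX -` S, DY -` S)"]) auto
  have "\<phi> $ R = (\<Sum>S\<in>UNIV. \<phi> $ S *\<^sub>R axis S 1) $ R" for R
  proof -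
    have "(\<Sum>S\<in>UNIV. \<phi> $ S *\<^sub>R axis S (1::real)) $ R = (\<Sum>S\<in>UNIV. if S = R then \<phi> $ S else 0)"
      unfolding sum_component by (rule sum.cong) (auto simp: axis_def)
    then show ?thesis by simp
  qed
  then have "\<phi> = (\<Sum>S\<in>UNIV. \<phi> $ S *\<^sub>R axis S 1)" unfolding vec_eq_iff by blast
  also have "\<dots> = (\<Sum>p\<in>UNIV. \<phi> $ (DX ` fst p \<union> DY ` snd p) *\<^sub>R axis (DX ` fst p \<union> DY ` snd p) 1)"
    by (rule sum.reindex_bij_betw[OF bij, symmetric])
  finally show ?thesis by (simp only: case_prod_unfold monomial_eq prod.collapse)
qed


section \<open>The classes of terms\<close>

text \<open>
  Each class is the set of pairs \<open>(A, B)\<close> of index sets such that \<open>dx^A dy^B\<close> is, up to sign, one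
  of the listed wedge monomials.
\<close>

definition class1 :: "(8 set \<times> 8 set) set" where
  "class1 = {({0,1,2,3,4,5,6,7}, {})}"

definition class2 :: "(8 set \<times> 8 set) set" where
  "class2 = {({i0,i1,i2,i3,i4,i5}, {i6,i7}) | i0 i1 i2 i3 i4 i5 i6 i7.
     distinct [i0,i1,i2,i3,i4,i5,i6,i7] \<and>
     i0 < i1 \<and> i1 < i2 \<and> i2 < i3 \<and> i3 < i4 \<and> i4 < i5 \<and> i6 < i7}"

definition class3 :: "(8 set \<times> 8 set) set" where
  "class3 = {({i0,i1,i2,i3,i4,i5}, {i4,i5}) | i0 i1 i2 i3 i4 i5.
     distinct [i0,i1,i2,i3,i4,i5] \<and>
     i0 < i1 \<and> i1 < i2 \<and> i2 < i3 \<and> i4 < i5 \<and> i0 \<odot> i1 \<odot> i2 \<odot> i3 = 0}"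

definition class4 :: "(8 set \<times> 8 set) set" where
  "class4 = {({i0,i1,i2,i3}, {i4,i5,i6,i7}) | i0 i1 i2 i3 i4 i5 i6 i7.
     distinct [i0,i1,i2,i3,i4,i5,i6,i7] \<and>
     i0 < i1 \<and> i1 < i2 \<and> i2 < i3 \<and> i4 < i5 \<and> i5 < i6 \<and> i6 < i7 \<and>
     i0 \<odot> i1 \<odot> i2 \<odot> i3 = 0}"

definition class5 :: "(8 set \<times> 8 set) set" where
  "class5 = {({i0,i1,i2,i3}, {i4,i5,i6,i7}) | i0 i1 i2 i3 i4 i5 i6 i7.
     distinct [i0,i1,i2,i3,i4,i5,i6,i7] \<and>
     i0 < i1 \<and> i1 < i2 \<and> i2 < i3 \<and> i4 < i5 \<and> i5 < i6 \<and> i6 < i7 \<and>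
     i0 \<odot> i1 \<odot> i2 \<odot> i3 \<noteq> 0}"

definition class6 :: "(8 set \<times> 8 set) set" where
  "class6 = {({i0,i1,i2,i3}, {i2,i3,i4,i5}) | i0 i1 i2 i3 i4 i5.
     distinct [i0,i1,i2,i3,i4,i5] \<and>
     i0 < i1 \<and> i2 < i3 \<and> i0 \<odot> i1 \<odot> i2 \<odot> i3 \<noteq> 0 \<and>
     i4 = i0 \<odot> i2 \<odot> i3 \<and> i5 = i1 \<odot> i2 \<odot> i3}"

definition class7 :: "(8 set \<times> 8 set) set" where
  "class7 = {({i0,i1,i2,i3}, {i0,i1,i2,i3}) | i0 i1 i2 i3.
     i0 < i1 \<and> i1 < i2 \<and> i2 < i3 \<and> i0 \<odot> i1 \<odot> i2 \<odot> i3 \<noteq> 0}"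

definition class8 :: "(8 set \<times> 8 set) set" where
  "class8 = {({i0,i1,i2,i3}, {i0,i1,i2,i3}) | i0 i1 i2 i3.
     i0 < i1 \<and> i1 < i2 \<and> i2 < i3 \<and> i0 \<odot> i1 \<odot> i2 \<odot> i3 = 0}"

definition class9 :: "(8 set \<times> 8 set) set" where
  "class9 = {({i0,i1}, {i0,i1,i2,i3,i4,i5}) | i0 i1 i2 i3 i4 i5.
     distinct [i0,i1,i2,i3,i4,i5] \<and>
     i0 < i1 \<and> i2 < i3 \<and> i3 < i4 \<and> i4 < i5 \<and> i2 \<odot> i3 \<odot> i4 \<odot> i5 = 0}"

definition class10 :: "(8 set \<times> 8 set) set" where
  "class10 = {({i0,i1}, {i2,i3,i4,i5,i6,i7}) | i0 i1 i2 i3 i4 i5 i6 i7.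
     distinct [i0,i1,i2,i3,i4,i5,i6,i7] \<and>
     i0 < i1 \<and> i2 < i3 \<and> i3 < i4 \<and> i4 < i5 \<and> i5 < i6 \<and> i6 < i7}"

definition class11 :: "(8 set \<times> 8 set) set" where
  "class11 = {({}, {0,1,2,3,4,5,6,7})}"

end

(*
Every coefficient of the forms involved is a real multiple of the single unit e_k, where k is the
product of the indices of the monomial, and Psi8 is invariant under conjugation.  Hence only the
monomials dx^A dy^B with equal index products of A and B contribute, and only the real part of
their coefficients matters.

Polarising the identity (u x) cnj(x) = |x|^2 u shows that the products defining Psi40, Psi31, Psi13
and Psi04 are already skew-symmetric in the indices of equal factors.  Up to sign, coefficients are
therefore 24 or 6 times a single product ((cnj(e_l) e_i) cnj(e_j)) e_k, and those of Psi8 are signed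
sums of at most 70 real parts of products of two units, which are evaluated.
The classes are told apart by the cardinalities of A and of the intersection of A and B, and by
whether the index product of A vanishes.
*)
theory Submission
  imports Defs
begin

section \<open>Signed units\<close>

text \<open>Non-associativity is the obstacle: the coefficient of a bracketed product of one-forms
  is a sum over all orders of the indices, and different orders need not be related. In the
  left-bracketed alternating pattern, however, any two neighbouring factors are a unit and a
  conjugated unit multiplied from the right onto one octonion (onto 1 for the first two), so the
  polarised identity applies to every adjacent transposition. This gives the factors 4! = 24 and 3!
  = 6. No product of eight units is ever formed, since the real part of a product of two octonions
  needs only their inner product and their real parts.

  The index product makes {0,...,7} an elementary abelian 2-group, that is, a three-dimensional
  space over the field with two elements. Four distinct indices with product 0 form one of its 14
  affine planes; the other 56 quadruples spread evenly over the seven non-zero products. The counts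
  come from this geometry: 702 = 2 * (1 + 28 + 84) + 14 + 14 + 56 + 56 + 336.

  With 4 * 6! = 2880, the integer sums 70, +-40 and 0, +-8, +-16 are scaled by 576/2880 = 1/5, 4 *
  36/2880 = 1/20 and 10 * 36/2880 = 1/8.\<close>

lemma index_mult_cases: "e i \<bullet>\<^sub>O e j = e (i \<odot> j) \<or> e i \<bullet>\<^sub>O e j = - e (i \<odot> j)"
proof -
  have "e (i \<odot> j) = e i \<bullet>\<^sub>O e j \<or> e (i \<odot> j) = - (e i \<bullet>\<^sub>O e j)"
    unfolding index_mult_def by (rule theI'[OF index_mult_ex1])
  then show ?thesis by auto
qed

lemma oct_coeff_zero: "k \<noteq> i \<odot> j \<Longrightarrow> oct_coeff i j k = 0"
  using index_mult_cases[of i j] by (auto simp flip: oct_mult_e_nth simp: e_nth)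

text \<open>A single non-vanishing structure constant determines the index product, so the
  \<open>THE\<close> in its definition never has to be unfolded again.\<close>

lemma index_mult_eqI: "oct_coeff i j k \<noteq> 0 \<Longrightarrow> i \<odot> j = k"
  using oct_coeff_zero by metis

definition oct_neg :: "8 \<Rightarrow> 8 \<Rightarrow> bool" where
  "oct_neg i j \<longleftrightarrow> oct_coeff i j (i \<odot> j) = -1"

text \<open>The pair \<open>(s, k)\<close> encodes a signed basis unit, with \<open>s\<close> true
  for the minus sign. Products of units then become lookups of truth values and indices instead of
  computations in \<open>real ^ 8\<close>.\<close>

fun unit :: "bool \<times> 8 \<Rightarrow> octonion" where
  "unit (s, k) = (if s then - e k else e k)"

fun unit_mult :: "bool \<times> 8 \<Rightarrow> bool \<times> 8 \<Rightarrow> bool \<times> 8" where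
  "unit_mult (s, i) (t, j) = (s \<noteq> (t \<noteq> oct_neg i j), i \<odot> j)"

fun unit_cnj :: "bool \<times> 8 \<Rightarrow> bool \<times> 8" where
  "unit_cnj (s, k) = (s \<noteq> (k \<noteq> 0), k)"

lemma e_mult: "e i \<bullet>\<^sub>O e j = unit (oct_neg i j, i \<odot> j)"
  using index_mult_cases[of i j]
  by (auto simp: oct_neg_def e_nth simp flip: oct_mult_e_nth)

lemma oct_mult_minus: "(- x) \<bullet>\<^sub>O y = - (x \<bullet>\<^sub>O y)" "x \<bullet>\<^sub>O (- y) = - (x \<bullet>\<^sub>O y)"
  by (simp_all add: oct_mult_def vec_eq_iff sum_negf)

lemma oct_mult_scaleR: "(a *\<^sub>R x) \<bullet>\<^sub>O y = a *\<^sub>R (x \<bullet>\<^sub>O y)" "x \<bullet>\<^sub>O (a *\<^sub>R y) = a *\<^sub>R (x \<bullet>\<^sub>O y)"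
  by (simp_all add: oct_mult_def vec_eq_iff sum_distrib_left mult_ac)

lemma oct_mult_add: "(x + y) \<bullet>\<^sub>O z = x \<bullet>\<^sub>O z + y \<bullet>\<^sub>O z" "z \<bullet>\<^sub>O (x + y) = z \<bullet>\<^sub>O x + z \<bullet>\<^sub>O y"
  by (simp_all add: oct_mult_def vec_eq_iff algebra_simps sum.distrib)

lemma oct_mult_zero: "0 \<bullet>\<^sub>O y = 0" "x \<bullet>\<^sub>O 0 = 0"
  by (simp_all add: oct_mult_def vec_eq_iff)

lemma unit_mult: "unit u \<bullet>\<^sub>O unit v = unit (unit_mult u v)"
  by (cases u; cases v) (auto simp: e_mult oct_mult_minus)

lemma unit_cnj: "oct_cnj (unit u) = unit (unit_cnj u)"
  by (cases u) (auto simp: oct_cnj_def vec_eq_iff e_nth)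

lemma unit_False: "e i = unit (False, i)" by simp

section \<open>The group of indices and the table of signs\<close>

lemma index_mult_0: "0 \<odot> i = i" "i \<odot> 0 = i"
  by (rule index_mult_eqI, simp add: oct_coeff_def)+

lemma index_mult_self: "i \<odot> i = 0"
  by (rule index_mult_eqI, simp add: oct_coeff_def)

text \<open>As one equation between lists, injectivity of the list constructors releases all 64
  rewrite rules at once.\<close>

lemma index_mult_rows:
  "map (\<lambda>i. map (\<lambda>j. i \<odot> j) [0,1,2,3,4,5,6,7]) [0,1,2,3,4,5,6,7] =
    [[0,1,2,3,4,5,6,7],
     [1,0,4,7,2,6,5,3],
     [2,4,0,5,1,3,7,6],
     [3,7,5,0,6,2,4,1],
     [4,2,1,6,0,7,3,5],
     [5,6,3,2,7,0,1,4],
     [6,5,7,4,3,1,0,2],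
     [7,3,6,1,5,4,2,0]]"
  by (simp only: list.map list.inject simp_thms)
    (intro conjI; rule index_mult_eqI; simp only: oct_eval; simp)

lemmas index_mult_table = index_mult_rows[unfolded list.map list.inject simp_thms]

text \<open>An entry 1 marks a product of units with a minus sign.\<close>

lemma oct_neg_rows:
  "map (\<lambda>i. map (\<lambda>j. oct_neg i j) [0,1,2,3,4,5,6,7]) [0,1,2,3,4,5,6,7] =
    map (map ((=) (1::nat)))
    [[0,0,0,0,0,0,0,0],
     [0,1,0,0,1,0,1,1],
     [0,1,1,0,0,1,0,1],
     [0,1,1,1,0,0,1,0],
     [0,0,1,1,1,0,0,1],
     [0,1,0,1,1,1,0,0],
     [0,0,1,0,1,1,1,0],
     [0,0,0,1,0,1,1,1]]"
  by (simp only: list.map list.inject simp_thms oct_neg_def index_mult_table oct_eval) simp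

lemmas oct_neg_table = oct_neg_rows[simplified]

lemma index_mult_commute: "i \<odot> j = j \<odot> i"
proof -
  have "\<forall>i j. i \<odot> j = j \<odot> i" by (simp only: forall_8 index_mult_table simp_thms)
  then show ?thesis by blast
qed

lemma index_mult_assoc: "(i \<odot> j) \<odot> k = i \<odot> (j \<odot> k)"
proof -
  have "\<forall>i j k. (i \<odot> j) \<odot> k = i \<odot> (j \<odot> k)" by (simp only: forall_8 index_mult_table simp_thms)
  then show ?thesis by blast
qed

lemma index_mult_left_commute: "i \<odot> (j \<odot> k) = j \<odot> (i \<odot> k)"
  unfolding index_mult_assoc[symmetric] index_mult_commute[of i j] ..

lemma comm_monoid_set_index_mult: "comm_monoid_set (\<odot>) 0"
  by (intro comm_monoid_set.intro comm_monoid.intro abel_semigroup.intro semigroup.intro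
      abel_semigroup_axioms.intro comm_monoid_axioms.intro
      index_mult_assoc index_mult_commute index_mult_0)

definition index_prod :: "('a \<Rightarrow> 8) \<Rightarrow> 'a set \<Rightarrow> 8" where
  "index_prod = comm_monoid_set.F (\<odot>) 0"

lemmas index_prod_empty [simp] =
  comm_monoid_set.empty[OF comm_monoid_set_index_mult, folded index_prod_def]
lemmas index_prod_insert [simp] =
  comm_monoid_set.insert[OF comm_monoid_set_index_mult, folded index_prod_def]
lemmas index_prod_reindex =
  comm_monoid_set.reindex[OF comm_monoid_set_index_mult, folded index_prod_def]
lemmas index_prod_union_disjoint =
  comm_monoid_set.union_disjoint[OF comm_monoid_set_index_mult, folded index_prod_def]

lemma index_mult_cancel: "i \<odot> (i \<odot> j) = j"
  by (simp add: index_mult_assoc[symmetric] index_mult_self index_mult_0)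

text \<open>Every index is its own inverse.\<close>

lemma index_mult_eq_iff: "i \<odot> j = k \<longleftrightarrow> j = i \<odot> k"
  using index_mult_cancel by metis

section \<open>Grading, bidegree and reality\<close>

abbreviation xy :: "8 set \<Rightarrow> 8 set \<Rightarrow> coord set" where
  "xy A B \<equiv> DX ` A \<union> DY ` B"

fun coord_index :: "coord \<Rightarrow> 8" where
  "coord_index (DX i) = i"
| "coord_index (DY i) = i"

text \<open>The octonions are graded by the group of indices, each \<open>e k\<close> spanning the
  component of degree \<open>k\<close>; the coefficient at a monomial is required to have the degree
  of that monomial.\<close>

definition graded :: "(octonion, coord) form \<Rightarrow> bool" where
  "graded F \<longleftrightarrow> (\<forall>S k. k \<noteq> index_prod coord_index S \<longrightarrow> F $ S $ k = 0)"

definition bidegree :: "nat \<Rightarrow> nat \<Rightarrow> (octonion, coord) form \<Rightarrow> bool" where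
  "bidegree p q F \<longleftrightarrow> (\<forall>A B. F $ xy A B \<noteq> 0 \<longrightarrow> card A = p \<and> card B = q)"

definition even_form :: "(octonion, 'n::finite) form \<Rightarrow> bool" where
  "even_form F \<longleftrightarrow> (\<forall>S. odd (card S) \<longrightarrow> F $ S = 0)"

lemma xy_collapse: "xy (DX -` S) (DY -` S) = S"
  using UNIV_coord by auto

lemma xy_eq_iff: "xy A B = xy A' B' \<longleftrightarrow> A = A' \<and> B = B'"
  by blast

lemma xy_Diff: "xy A B - xy A' B' = xy (A - A') (B - B')"
  by blast

lemma card_xy: "card (xy A B) = card A + card B"
  by (subst card_Un_disjoint) (auto simp: card_image inj_on_def)

lemma Pow_xy: "Pow (xy A B) = (\<lambda>(A', B'). xy A' B') ` (Pow A \<times> Pow B)"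
proof (intro equalityI subsetI)
  fix S assume "S \<in> Pow (xy A B)"
  then have "DX -` S \<subseteq> A" "DY -` S \<subseteq> B" by auto
  then show "S \<in> (\<lambda>(A', B'). xy A' B') ` (Pow A \<times> Pow B)"
    by (intro rev_image_eqI[of "(DX -` S, DY -` S)"]) (use xy_collapse[of S] in auto)
qed auto

lemma index_prod_xy:
  "index_prod coord_index (xy A B) = index_prod (\<lambda>i. i) A \<odot> index_prod (\<lambda>i. i) B"
  by (subst index_prod_union_disjoint) (auto simp: index_prod_reindex inj_on_def comp_def)

section \<open>Conjugation, grading and bidegree under the wedge product\<close>

lemma oct_cnj_mult: "oct_cnj (x \<bullet>\<^sub>O y) = oct_cnj y \<bullet>\<^sub>O oct_cnj x"
  by (simp add: vec_eq_iff forall_8 oct_cnj_def oct_mult_nth)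

lemma oct_cnj_linear:
  "oct_cnj 0 = 0" "oct_cnj (x + y) = oct_cnj x + oct_cnj y" "oct_cnj (- x) = - oct_cnj x"
  "oct_cnj (a *\<^sub>R x) = a *\<^sub>R oct_cnj x" "oct_cnj (x - y) = oct_cnj x - oct_cnj y"
  by (simp_all add: oct_cnj_def vec_eq_iff)

lemma oct_cnj_cnj: "oct_cnj (oct_cnj x) = x"
  by (simp add: oct_cnj_def vec_eq_iff)

lemma oct_cnj_sum: "oct_cnj (sum f A) = (\<Sum>a\<in>A. oct_cnj (f a))"
  by (induction A rule: infinite_finite_induct) (simp_all add: oct_cnj_linear)

lemma form_cnj_nth: "form_cnj F $ S = oct_cnj (F $ S)"
  by (simp add: form_cnj_def)

text \<open>Each pair in \<open>T \<times> U\<close> is an inversion for exactly one of the two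
  orders, so the two inversion counts add up to \<open>card T * card U\<close>.\<close>

lemma wedge_sign_commute:
  assumes "T \<inter> U = {}"
  shows "wedge_sign T U = (-1) ^ (card T * card U) * wedge_sign U T"
proof -
  let ?I = "{(i, j). i \<in> T \<and> j \<in> U \<and> j < i}" and ?J = "{(i, j). i \<in> U \<and> j \<in> T \<and> j < i}"
  have "T \<times> U = ?I \<union> prod.swap ` ?J"
    using assms by (auto simp: image_iff not_less order.strict_iff_order)
  moreover have "?I \<inter> prod.swap ` ?J = {}" by auto
  ultimately have "card T * card U = card ?I + card ?J"
    by (simp add: card_Un_disjoint card_image flip: card_cartesian_product)
  then have "(-1) ^ (card T * card U) * wedge_sign U T = (-1) ^ card ?I * ((-1) ^ card ?J * (-1) ^ card ?J)"
    by (simp add: wedge_sign_def power_add)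
  also have "\<dots> = wedge_sign T U"
    by (simp add: wedge_sign_def flip: power_mult_distrib)
  finally show ?thesis ..
qed

text \<open>Octonion conjugation reverses products, and exchanging the two monomials costs a sign
  that can be -1 only if both have odd degree. An even left factor excludes this.\<close>

lemma form_cnj_wedge:
  assumes "even_form F"
  shows "form_cnj (F \<and>\<^sub>O G) = form_cnj G \<and>\<^sub>O form_cnj F"
proof -
  have "form_cnj (F \<and>\<^sub>O G) $ S = (form_cnj G \<and>\<^sub>O form_cnj F) $ S" for S
  proof -
    have "form_cnj (F \<and>\<^sub>O G) $ S =
        (\<Sum>T\<in>Pow S. wedge_sign T (S - T) *\<^sub>R (oct_cnj (G $ (S - T)) \<bullet>\<^sub>O oct_cnj (F $ T)))"
      by (simp add: form_cnj_nth wedge_by_nth oct_cnj_sum oct_cnj_linear oct_cnj_mult)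
    also have "\<dots> = (\<Sum>T\<in>Pow S. wedge_sign (S - T) T *\<^sub>R (oct_cnj (G $ (S - T)) \<bullet>\<^sub>O oct_cnj (F $ T)))"
    proof (rule sum.cong[OF refl])
      fix T
      show "wedge_sign T (S - T) *\<^sub>R (oct_cnj (G $ (S - T)) \<bullet>\<^sub>O oct_cnj (F $ T)) =
          wedge_sign (S - T) T *\<^sub>R (oct_cnj (G $ (S - T)) \<bullet>\<^sub>O oct_cnj (F $ T))"
        using assms wedge_sign_commute[of T "S - T"]
        by (cases "even (card T)") (auto simp: even_form_def oct_cnj_linear oct_mult_zero)
    qed
    also have "\<dots> = (form_cnj G \<and>\<^sub>O form_cnj F) $ S"
      unfolding wedge_by_nth form_cnj_nth
      by (rule sum.reindex_bij_witness[where i = "\<lambda>T. S - T" and j = "\<lambda>T. S - T"])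
        (auto simp: double_diff)
    finally show ?thesis .
  qed
  then show ?thesis by (simp add: vec_eq_iff)
qed

lemma form_cnj_cnj: "form_cnj (form_cnj F) = F"
  by (simp add: form_cnj_def oct_cnj_cnj vec_eq_iff)

lemma graded_form_cnj: "graded F \<Longrightarrow> graded (form_cnj F)"
  by (simp add: graded_def form_cnj_def oct_cnj_def)

text \<open>The index product of \<open>S\<close> is that of \<open>T\<close> times that of
  \<open>S - T\<close>, and a product of units of these degrees lies in the product degree.\<close>

lemma graded_wedge:
  assumes "graded F" "graded G"
  shows "graded (F \<and>\<^sub>O G)"
  unfolding graded_def
proof (intro allI impI)
  fix S k assume k: "k \<noteq> index_prod coord_index S"
  have "(F $ T \<bullet>\<^sub>O G $ (S - T)) $ k = 0" if "T \<in> Pow S" for T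
  proof -
    have "T \<union> (S - T) = S" using that by auto
    then have S: "index_prod coord_index S = index_prod coord_index T \<odot> index_prod coord_index (S - T)"
      using index_prod_union_disjoint[of T "S - T" coord_index] by simp
    have "oct_coeff i j k * F $ T $ i * G $ (S - T) $ j = 0" for i j
    proof (cases "i = index_prod coord_index T \<and> j = index_prod coord_index (S - T)")
      case True
      then show ?thesis using k S by (simp add: oct_coeff_zero)
    next
      case False
      then show ?thesis using assms by (auto simp: graded_def)
    qed
    then show ?thesis by (simp only: oct_mult_def vec_lambda_beta sum.neutral_const)
  qed
  then show "(F \<and>\<^sub>O G) $ S $ k = 0" by (simp add: wedge_by_nth)
qed

lemma graded_add: "graded F \<Longrightarrow> graded G \<Longrightarrow> graded (F + G)"
  by (simp add: graded_def)

lemma graded_diff: "graded F \<Longrightarrow> graded G \<Longrightarrow> graded (F - G)"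
  by (simp add: graded_def)

lemma graded_scaleR: "graded F \<Longrightarrow> graded (a *\<^sub>R F)"
  by (simp add: graded_def)

lemma bidegree_nth: "bidegree p q F \<Longrightarrow> \<not> (card A = p \<and> card B = q) \<Longrightarrow> F $ xy A B = 0"
  unfolding bidegree_def by blast

lemma bidegree_form_cnj: "bidegree p q F \<Longrightarrow> bidegree p q (form_cnj F)"
  unfolding bidegree_def form_cnj_nth by (metis oct_cnj_linear(1))

lemma bidegree_even: "bidegree p q F \<Longrightarrow> even (p + q) \<Longrightarrow> even_form F"
  unfolding bidegree_def even_form_def by (metis xy_collapse card_xy)

text \<open>All \<open>DX\<close> coordinates precede all \<open>DY\<close> coordinates. The only
  inversions between the two kinds come from moving the \<open>DY\<close> part of the left factor
  past the \<open>DX\<close> part of the right factor, and there every pair counts.\<close>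

lemma wedge_sign_xy:
  "wedge_sign (xy A B) (xy A' B') =
    (-1) ^ (card B * card A') * (wedge_sign A A' * wedge_sign B B')"
proof -
  have inj: "inj_on (map_prod f f) Q" if "inj f" for f :: "8 \<Rightarrow> coord" and Q
    using that by (auto simp: inj_on_def)
  have XX: "wedge_sign (DX ` A) (DX ` A') = wedge_sign A A'"
    and YY: "wedge_sign (DY ` B) (DY ` B') = wedge_sign B B'"
  proof -
    have "{(p, q). p \<in> DX ` A \<and> q \<in> DX ` A' \<and> q < p} =
        map_prod DX DX ` {(i, j). i \<in> A \<and> j \<in> A' \<and> j < i}"
      by (auto simp: less_coord_simps)
    moreover have "{(p, q). p \<in> DY ` B \<and> q \<in> DY ` B' \<and> q < p} =
        map_prod DY DY ` {(i, j). i \<in> B \<and> j \<in> B' \<and> j < i}"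
      by (auto simp: less_coord_simps)
    ultimately show "wedge_sign (DX ` A) (DX ` A') = wedge_sign A A'"
      "wedge_sign (DY ` B) (DY ` B') = wedge_sign B B'"
      by (simp_all add: wedge_sign_def card_image inj inj_on_def)
  qed
  have "{(p, q). p \<in> DX ` A \<and> q \<in> DY ` B' \<and> q < p} = {}"
    by (auto simp: less_coord_simps)
  then have XY: "wedge_sign (DX ` A) (DY ` B') = 1"
    by (simp only: wedge_sign_def card.empty power_0)
  have "{(p, q). p \<in> DY ` B \<and> q \<in> DX ` A' \<and> q < p} = DY ` B \<times> DX ` A'"
    by (auto simp: less_coord_simps)
  then have YX: "wedge_sign (DY ` B) (DX ` A') = (-1) ^ (card B * card A')"
    by (simp only: wedge_sign_def card_cartesian_product) (simp add: card_image inj_on_def)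
  have "DX ` A \<inter> DY ` B = {}" "DX ` A' \<inter> DY ` B' = {}" by auto
  then show ?thesis
    by (simp add: wedge_sign_Un_left wedge_sign_Un_right XX XY YX YY)
qed

lemma wedge_xy:
  "(F \<and>\<^sub>O G) $ xy A B = (\<Sum>A'\<in>Pow A. \<Sum>B'\<in>Pow B.
     ((-1) ^ (card B' * card (A - A')) * (wedge_sign A' (A - A') * wedge_sign B' (B - B'))) *\<^sub>R
       (F $ xy A' B' \<bullet>\<^sub>O G $ xy (A - A') (B - B')))"
proof -
  have "inj_on (\<lambda>(A', B'). xy A' B') (Pow A \<times> Pow B)"
    unfolding inj_on_def case_prod_unfold xy_eq_iff by (auto simp: prod_eq_iff)
  then show ?thesis
    by (simp add: wedge_by_nth Pow_xy sum.reindex sum.cartesian_product case_prod_unfold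
        xy_Diff wedge_sign_xy)
qed

lemma bidegree_wedge:
  assumes "bidegree p q F" "bidegree p' q' G"
  shows "bidegree (p + p') (q + q') (F \<and>\<^sub>O G)"
  unfolding bidegree_def
proof (intro allI impI)
  fix A B assume "(F \<and>\<^sub>O G) $ xy A B \<noteq> 0"
  then obtain A' B' where AB: "A' \<subseteq> A" "B' \<subseteq> B"
    and "F $ xy A' B' \<bullet>\<^sub>O G $ xy (A - A') (B - B') \<noteq> 0"
    unfolding wedge_xy
    by (metis (no_types, lifting) PowD scaleR_zero_right sum.not_neutral_contains_not_neutral)
  then have "F $ xy A' B' \<noteq> 0" "G $ xy (A - A') (B - B') \<noteq> 0"
    by (auto simp: oct_mult_zero)
  then have "card A' = p" "card B' = q" "card (A - A') = p'" "card (B - B') = q'"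
    using assms unfolding bidegree_def by blast+
  then show "card A = p + p' \<and> card B = q + q'"
    using AB by (metis card_Diff_subset card_mono finite le_add_diff_inverse)
qed

section \<open>Coefficients of the four-forms\<close>

text \<open>Free coefficients \<open>v\<close> allow \<open>dx\<close>, \<open>dy\<close> and their
  conjugates to be treated alike.\<close>

definition one_form :: "(8 \<Rightarrow> octonion) \<Rightarrow> (8 \<Rightarrow> 'n::{finite,linorder}) \<Rightarrow> (octonion, 'n) form" where
  "one_form v h = (\<Sum>i\<in>UNIV. v i \<otimes> coord_form (h i))"

text \<open>The pattern common to the four forms. In \<open>Psi31\<close> and \<open>Psi13\<close>
  the first index belongs to the factor that differs from the other three.\<close>

definition oct_word :: "8 \<Rightarrow> 8 \<Rightarrow> 8 \<Rightarrow> 8 \<Rightarrow> octonion" where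
  "oct_word l i j k = ((oct_cnj (e l) \<bullet>\<^sub>O e i) \<bullet>\<^sub>O oct_cnj (e j)) \<bullet>\<^sub>O e k"

text \<open>Polarised forms of the identities \<open>(u x) x\<^sup>* = |x|\<^sup>2 u = (u x\<^sup>*) x\<close>.\<close>

lemma oct_clifford:
  "(u \<bullet>\<^sub>O x) \<bullet>\<^sub>O oct_cnj y + (u \<bullet>\<^sub>O y) \<bullet>\<^sub>O oct_cnj x = (2 * (x \<bullet> y)) *\<^sub>R u"
  "(u \<bullet>\<^sub>O oct_cnj x) \<bullet>\<^sub>O y + (u \<bullet>\<^sub>O oct_cnj y) \<bullet>\<^sub>O x = (2 * (x \<bullet> y)) *\<^sub>R u"
  by (simp_all add: vec_eq_iff forall_8 oct_mult_nth oct_cnj_def inner_vec_def sum_8 algebra_simps)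

lemma inner_e: "e i \<bullet> e j = of_bool (i = j)"
  by (simp add: e_def inner_axis_axis)

text \<open>Distinct units are orthogonal, so the right-hand sides of the polarised identities
  vanish. The three swaps are the adjacent transpositions of the four positions; the last one takes
  \<open>u = 1\<close>.\<close>

lemma oct_word_swap:
  "i \<noteq> j \<Longrightarrow> oct_word l j i k = - oct_word l i j k"
  "j \<noteq> k \<Longrightarrow> oct_word l i k j = - oct_word l i j k"
  "l \<noteq> i \<Longrightarrow> oct_word i l j k = - oct_word l i j k"
proof -
  assume "i \<noteq> j"
  then have "(u \<bullet>\<^sub>O e j) \<bullet>\<^sub>O oct_cnj (e i) = - ((u \<bullet>\<^sub>O e i) \<bullet>\<^sub>O oct_cnj (e j))" for u
    using oct_clifford(1)[of u "e i" "e j"] by (simp add: inner_e eq_neg_iff_add_eq_0 add.commute)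
  then show "oct_word l j i k = - oct_word l i j k"
    by (simp add: oct_word_def oct_mult_minus)
next
  assume "j \<noteq> k"
  then have "(u \<bullet>\<^sub>O oct_cnj (e k)) \<bullet>\<^sub>O e j = - ((u \<bullet>\<^sub>O oct_cnj (e j)) \<bullet>\<^sub>O e k)" for u
    using oct_clifford(2)[of u "e j" "e k"] by (simp add: inner_e eq_neg_iff_add_eq_0 add.commute)
  then show "oct_word l i k j = - oct_word l i j k"
    by (simp add: oct_word_def oct_mult_minus)
next
  assume "l \<noteq> i"
  then have "oct_cnj (e i) \<bullet>\<^sub>O e l = - (oct_cnj (e l) \<bullet>\<^sub>O e i)"
    using oct_clifford(2)[of "e 0" "e l" "e i"]
    by (simp add: inner_e oct_mult_one eq_neg_iff_add_eq_0 add.commute)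
  then show "oct_word i l j k = - oct_word l i j k"
    by (simp add: oct_word_def oct_mult_minus)
qed

lemma wedge_tensor_coord_form:
  "(F \<and>\<^sub>O (u \<otimes> coord_form a)) $ S =
    (if a \<in> S then wedge_sign (S - {a}) {a} *\<^sub>R (F $ (S - {a}) \<bullet>\<^sub>O u) else 0)"
proof -
  have "(F \<and>\<^sub>O (u \<otimes> coord_form a)) $ S =
      (\<Sum>T\<in>Pow S. if T = S - {a} then (if a \<in> S then wedge_sign T {a} *\<^sub>R (F $ T \<bullet>\<^sub>O u) else 0) else 0)"
    unfolding wedge_by_nth
  proof (rule sum.cong[OF refl])
    fix T assume "T \<in> Pow S"
    then have "S - T = {a} \<longleftrightarrow> T = S - {a} \<and> a \<in> S" by auto
    then show "wedge_sign T (S - T) *\<^sub>R (F $ T \<bullet>\<^sub>O (u \<otimes> coord_form a) $ (S - T)) =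
        (if T = S - {a} then (if a \<in> S then wedge_sign T {a} *\<^sub>R (F $ T \<bullet>\<^sub>O u) else 0) else 0)"
      by (auto simp: tensor_def coord_form_def axis_def oct_mult_zero)
  qed
  also have "\<dots> = (if a \<in> S then wedge_sign (S - {a}) {a} *\<^sub>R (F $ (S - {a}) \<bullet>\<^sub>O u) else 0)"
    by (subst sum.delta) auto
  finally show ?thesis .
qed

text \<open>Multiplication by a one-form on the right removes one coordinate from the monomial.
  Iterated, this expands a left-bracketed product of one-forms from its last factor inwards.\<close>

lemma wedge_one_form:
  "(F \<and>\<^sub>O one_form v h) $ S =
    (\<Sum>i | h i \<in> S. wedge_sign (S - {h i}) {h i} *\<^sub>R (F $ (S - {h i}) \<bullet>\<^sub>O v i))"
proof -
  have "F \<and>\<^sub>O sum G I = (\<Sum>i\<in>I. F \<and>\<^sub>O G i)" for G :: "8 \<Rightarrow> (octonion, 'a) form" and I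
  proof (induction I rule: infinite_finite_induct)
    case (insert i I)
    then show ?case by (simp add: oct_wedge_add)
  qed (simp_all add: vec_eq_iff wedge_by_nth oct_mult_def)
  then have "(F \<and>\<^sub>O one_form v h) $ S = (\<Sum>i\<in>UNIV. (F \<and>\<^sub>O (v i \<otimes> coord_form (h i))) $ S)"
    by (simp add: one_form_def)
  also have "\<dots> = (\<Sum>i | h i \<in> S. wedge_sign (S - {h i}) {h i} *\<^sub>R (F $ (S - {h i}) \<bullet>\<^sub>O v i))"
    unfolding wedge_tensor_coord_form by (subst sum.inter_filter[symmetric]) simp_all
  finally show ?thesis .
qed

lemma xy_Diff_single: "xy A B - {DX i} = xy (A - {i}) B" "xy A B - {DY i} = xy A (B - {i})"
  by auto

lemma wedge_one_form_DX:
  "(F \<and>\<^sub>O one_form v DX) $ xy A B =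
    (\<Sum>i\<in>A. ((-1) ^ card B * wedge_sign (A - {i}) {i}) *\<^sub>R (F $ xy (A - {i}) B \<bullet>\<^sub>O v i))"
proof -
  have "{i. DX i \<in> xy A B} = A" by auto
  moreover have "wedge_sign (xy A' B) {DX i} = (-1) ^ card B * wedge_sign A' {i}" for A' i
    using wedge_sign_xy[of A' B "{i}" "{}"] by (simp add: wedge_sign_empty)
  ultimately show ?thesis unfolding wedge_one_form xy_Diff_single by simp
qed

lemma wedge_one_form_DY:
  "(F \<and>\<^sub>O one_form v DY) $ xy A B =
    (\<Sum>i\<in>B. wedge_sign (B - {i}) {i} *\<^sub>R (F $ xy A (B - {i}) \<bullet>\<^sub>O v i))"
proof -
  have "{i. DY i \<in> xy A B} = B" by auto
  moreover have "wedge_sign (xy A B') {DY i} = wedge_sign B' {i}" for B' i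
    using wedge_sign_xy[of A B' "{}" "{i}"] by (simp add: wedge_sign_empty)
  ultimately show ?thesis unfolding wedge_one_form xy_Diff_single by simp
qed

lemma one_form_nth:
  "one_form v DX $ xy {i} {} = v i" "one_form v DY $ xy {} {i} = v i"
  by (simp_all add: one_form_def tensor_def coord_form_def axis_def
      if_distrib[of "\<lambda>x. x *\<^sub>R _"] cong: if_cong)

lemma dx_one_form: "dx = one_form e DX" "form_cnj dx = one_form (\<lambda>i. oct_cnj (e i)) DX"
  and dy_one_form: "dy = one_form e DY" "form_cnj dy = one_form (\<lambda>i. oct_cnj (e i)) DY"
  by (simp_all add: dx_def dy_def one_form_def form_cnj_def oct_cnj_sum tensor_def oct_cnj_linear
      vec_eq_iff)

lemma wedge_sign_insert:
  "a \<notin> T \<Longrightarrow> wedge_sign (insert a T) {b} = (if b < a then -1 else 1) * wedge_sign T {b}"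
proof -
  assume "a \<notin> T"
  moreover have "{(i, j). i \<in> {a} \<and> j \<in> {b} \<and> j < i} = (if b < a then {(a, b)} else {})"
    by auto
  then have "wedge_sign {a} {b} = (if b < a then -1 else 1)"
    by (simp add: wedge_sign_def)
  ultimately show ?thesis using wedge_sign_Un_left[of "{a}" T "{b}"] by simp
qed

lemma oct_mult_diff: "(x - y) \<bullet>\<^sub>O z = x \<bullet>\<^sub>O z - y \<bullet>\<^sub>O z" "z \<bullet>\<^sub>O (x - y) = z \<bullet>\<^sub>O x - z \<bullet>\<^sub>O y"
  by (simp_all add: oct_mult_def vec_eq_iff algebra_simps sum_subtractf)

text \<open>A numeral times a vector is a componentwise product with a constant vector; reading it
  as a scalar multiple makes the bilinearity rules of \<open>oct_mult\<close> applicable.\<close>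

lemma oct_numeral_times: "numeral n * x = numeral n *\<^sub>R x" for x :: octonion
  by (simp add: vec_eq_iff)

lemma bidegree_dx: "bidegree 1 0 dx" and bidegree_dy: "bidegree 0 1 dy"
proof -
  have X: "coord_form (DX i) $ xy A B = 0" if "\<not> (card A = 1 \<and> card B = 0)" for A B i
  proof -
    have "xy A B \<noteq> {DX i}" using that xy_eq_iff[of A B "{i}" "{}"] by auto
    then show ?thesis by (simp only: coord_form_def axis_def vec_lambda_beta if_False)
  qed
  have Y: "coord_form (DY i) $ xy A B = 0" if "\<not> (card A = 0 \<and> card B = 1)" for A B i
  proof -
    have "xy A B \<noteq> {DY i}" using that xy_eq_iff[of A B "{}" "{i}"] by auto
    then show ?thesis by (simp only: coord_form_def axis_def vec_lambda_beta if_False)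
  qed
  have "dx $ xy A B = 0" if "\<not> (card A = 1 \<and> card B = 0)" for A B
    unfolding dx_def tensor_def sum_component vec_lambda_beta X[OF that] by simp
  then show "bidegree 1 0 dx" unfolding bidegree_def by blast
  have "dy $ xy A B = 0" if "\<not> (card A = 0 \<and> card B = 1)" for A B
    unfolding dy_def tensor_def sum_component vec_lambda_beta Y[OF that] by simp
  then show "bidegree 0 1 dy" unfolding bidegree_def by blast
qed

lemma graded_dx: "graded dx" and graded_dy: "graded dy"
  unfolding graded_def
  by (auto simp: dx_def dy_def tensor_def coord_form_def axis_def e_def index_mult_0
      intro!: sum.neutral)

lemma bidegree_Psi:
  "bidegree 4 0 Psi40" "bidegree 3 1 Psi31" "bidegree 1 3 Psi13" "bidegree 0 4 Psi04"
proof -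
  note D = bidegree_wedge bidegree_form_cnj bidegree_dx bidegree_dy
  have "bidegree (1+0+0+0) (0+1+1+1) Psi13"
    unfolding Psi13_def by (intro D)
  then show "bidegree 1 3 Psi13" by (simp add: numeral_eq_Suc)
  have "bidegree (0+1+1+1) (1+0+0+0) Psi31"
    unfolding Psi31_def by (intro D)
  then show "bidegree 3 1 Psi31" by (simp add: numeral_eq_Suc)
  have "bidegree (1+1+1+1) (0+0+0+0) Psi40"
    unfolding Psi40_def by (intro D)
  then show "bidegree 4 0 Psi40" by (simp add: numeral_eq_Suc)
  have "bidegree (0+0+0+0) (1+1+1+1) Psi04"
    unfolding Psi04_def by (intro D)
  then show "bidegree 0 4 Psi04" by (simp add: numeral_eq_Suc)
qed

lemma graded_Psi: "graded Psi40" "graded Psi31" "graded Psi13" "graded Psi04"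
  unfolding Psi40_def Psi31_def Psi13_def Psi04_def
  by (intro graded_wedge graded_form_cnj graded_dx graded_dy)+

lemma even_Psi: "even_form Psi40" "even_form Psi31" "even_form Psi13" "even_form Psi04"
  by (rule bidegree_even, rule bidegree_Psi, simp)+

section \<open>Skew-symmetry of words and the coefficients of the four-forms\<close>

context
  fixes i j k :: 8
  assumes ijk: "i < j" "j < k"
begin

lemma ijk_neq: "i \<noteq> j" "j \<noteq> i" "i \<noteq> k" "k \<noteq> i" "j \<noteq> k" "k \<noteq> j"
    "\<not> j < i" "\<not> k < j" "\<not> k < i" "i < k"
  using ijk by auto

text \<open>Only the last three positions are permuted, so \<open>l\<close> may coincide with one of
  \<open>i\<close>, \<open>j\<close>, \<open>k\<close>, as it can in the mixed forms.\<close>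

lemma oct_word_perm:
  "oct_word l j i k = - oct_word l i j k"
  "oct_word l i k j = - oct_word l i j k"
  "oct_word l j k i = oct_word l i j k"
  "oct_word l k i j = oct_word l i j k"
  "oct_word l k j i = - oct_word l i j k"
  using ijk_neq by (metis minus_minus oct_word_swap(1,2))+

text \<open>The six orders of the \<open>dx\<close> factors contribute equally; the minus sign comes
  from moving the leading \<open>dy\<close> factor past three \<open>dx\<close> factors.\<close>

lemma Psi31_nth: "Psi31 $ xy {i, j, k} {l} = - 6 *\<^sub>R oct_word l i j k"
  unfolding Psi31_def
  \<comment> \<open>The conjugates go first, since rewriting \<open>dx\<close> would destroy the
    term \<open>form_cnj dx\<close>.\<close>
  unfolding dx_one_form(2) dy_one_form(2)
  unfolding dx_one_form(1) dy_one_form(1) wedge_one_form_DX wedge_one_form_DY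
  \<comment> \<open>Image and union rules are switched off so that the innermost
    \<open>xy {i} {}\<close> still matches \<open>one_form_nth\<close>.\<close>
  by (simp add: ijk ijk_neq insert_Diff_if wedge_sign_insert wedge_sign_empty one_form_nth
      oct_mult_minus oct_mult_scaleR oct_mult_add oct_mult_diff oct_numeral_times
      oct_word_perm[unfolded oct_word_def] oct_word_def
      del: image_insert image_empty Un_insert_left Un_insert_right Un_empty_left Un_empty_right;
      simp add: vec_eq_iff)

text \<open>Here the leading factor is the \<open>dx\<close> factor and is already in place, hence
  no minus sign.\<close>

lemma Psi13_nth: "Psi13 $ xy {l} {i, j, k} = 6 *\<^sub>R oct_word l i j k"
  unfolding Psi13_def
  unfolding dx_one_form(2) dy_one_form(2)
  unfolding dx_one_form(1) dy_one_form(1) wedge_one_form_DX wedge_one_form_DY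
  by (simp add: ijk ijk_neq insert_Diff_if wedge_sign_insert wedge_sign_empty one_form_nth
      oct_mult_minus oct_mult_scaleR oct_mult_add oct_mult_diff oct_numeral_times
      oct_word_perm[unfolded oct_word_def] oct_word_def
      del: image_insert image_empty Un_insert_left Un_insert_right Un_empty_left Un_empty_right;
      simp add: vec_eq_iff)

context
  fixes l :: 8
  assumes l: "k < l"
begin

lemma l_neq: "i \<noteq> l" "l \<noteq> i" "j \<noteq> l" "l \<noteq> j" "k \<noteq> l" "l \<noteq> k"
    "\<not> l < i" "\<not> l < j" "\<not> l < k" "i < l" "j < l"
  using ijk l by auto

text \<open>These bring the smallest index to the front; the remaining orders then follow from
  permutations of the last three positions.\<close>

lemma oct_word_perm_4:
  "oct_word j i k l = - oct_word i j k l"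
  "oct_word k i j l = oct_word i j k l"
  "oct_word l i j k = - oct_word i j k l"
  using ijk_neq l_neq by (metis minus_minus oct_word_swap)+

lemma oct_word_perm_all:
  "oct_word i j l k = - oct_word i j k l"
  "oct_word i k j l = - oct_word i j k l"
  "oct_word i k l j = oct_word i j k l"
  "oct_word i l j k = oct_word i j k l"
  "oct_word i l k j = - oct_word i j k l"
  "oct_word j i l k = oct_word i j k l"
  "oct_word j k i l = oct_word i j k l"
  "oct_word j k l i = - oct_word i j k l"
  "oct_word j l i k = - oct_word i j k l"
  "oct_word j l k i = oct_word i j k l"
  "oct_word k i l j = - oct_word i j k l"
  "oct_word k j i l = - oct_word i j k l"
  "oct_word k j l i = oct_word i j k l"
  "oct_word k l i j = oct_word i j k l"
  "oct_word k l j i = - oct_word i j k l"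
  "oct_word l i k j = oct_word i j k l"
  "oct_word l j i k = oct_word i j k l"
  "oct_word l j k i = - oct_word i j k l"
  "oct_word l k i j = - oct_word i j k l"
  "oct_word l k j i = oct_word i j k l"
  using oct_word_perm oct_word_perm_4 ijk_neq l_neq
  by (metis minus_minus oct_word_swap(1,2))+

lemma Psi40_nth: "Psi40 $ xy {i, j, k, l} {} = 24 *\<^sub>R oct_word i j k l"
  unfolding Psi40_def
  unfolding dx_one_form(2) dy_one_form(2)
  unfolding dx_one_form(1) dy_one_form(1) wedge_one_form_DX wedge_one_form_DY
  by (simp add: ijk ijk_neq l l_neq insert_Diff_if wedge_sign_insert wedge_sign_empty one_form_nth
      oct_mult_minus oct_mult_scaleR oct_mult_add oct_mult_diff oct_numeral_times
      oct_word_perm_all[unfolded oct_word_def] oct_word_perm_4[unfolded oct_word_def] oct_word_def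
      del: image_insert image_empty Un_insert_left Un_insert_right Un_empty_left Un_empty_right;
      simp add: vec_eq_iff)

lemma Psi04_nth: "Psi04 $ xy {} {i, j, k, l} = 24 *\<^sub>R oct_word i j k l"
  unfolding Psi04_def
  unfolding dx_one_form(2) dy_one_form(2)
  unfolding dx_one_form(1) dy_one_form(1) wedge_one_form_DX wedge_one_form_DY
  by (simp add: ijk ijk_neq l l_neq insert_Diff_if wedge_sign_insert wedge_sign_empty one_form_nth
      oct_mult_minus oct_mult_scaleR oct_mult_add oct_mult_diff oct_numeral_times
      oct_word_perm_all[unfolded oct_word_def] oct_word_perm_4[unfolded oct_word_def] oct_word_def
      del: image_insert image_empty Un_insert_left Un_insert_right Un_empty_left Un_empty_right;
      simp add: vec_eq_iff)

end

end

section \<open>Coefficients of the eight-form\<close>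

text \<open>
  \<open>splits n xs\<close> lists the ways to divide the increasing list \<open>xs\<close> into increasing lists \<open>ys\<close>, of
  length \<open>n\<close>, and \<open>zs\<close>; the truth value tells whether \<open>dx\<^sup>y\<^sup>s \<and> dx\<^sup>z\<^sup>s\<close> is \<open>- dx\<^sup>x\<^sup>s\<close>.
\<close>

fun splits :: "nat \<Rightarrow> 'a list \<Rightarrow> (bool \<times> 'a list \<times> 'a list) list" where
  "splits 0 xs = [(False, [], xs)]"
| "splits (Suc n) [] = []"
| "splits (Suc n) (x # xs) =
    map (\<lambda>(s, ys, zs). (s, x # ys, zs)) (splits n xs) @
    map (\<lambda>(s, ys, zs). (s \<noteq> odd (Suc n), ys, x # zs)) (splits (Suc n) xs)"

abbreviation sg :: "bool \<Rightarrow> 'a::{one,uminus}" where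
  "sg s \<equiv> (if s then - 1 else 1)"

text \<open>This replaces a sum over subsets by a sum over an explicit list that the simplifier can
  evaluate. The induction is Pascal's rule: a subset of size \<open>Suc n\<close> either contains
  the head \<open>x\<close> or lies in the tail.\<close>

lemma sum_splits:
  assumes "distinct xs"
  shows "(\<Sum>A | A \<subseteq> set xs \<and> card A = n. f A (set xs - A)) =
    (\<Sum>(s, ys, zs)\<leftarrow>splits n xs. f (set ys) (set zs))"
  using assms
proof (induction n xs arbitrary: f rule: splits.induct)
  case (1 xs)
  have "{A. A \<subseteq> set xs \<and> card A = 0} = {{}}"
    by (auto dest: finite_subset)
  then show ?case by simp
next
  case (2 n)
  show ?case by (auto intro!: sum.neutral)
next
  case (3 n x xs)
  let ?I = "\<lambda>n. {A. A \<subseteq> set xs \<and> card A = n}"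
  have x: "x \<notin> set xs" using 3 by simp
  have fin: "finite (?I n)" for n by (rule finite_subset[of _ "Pow (set xs)"]) auto
  have sub: "finite A" "x \<notin> A" if "A \<subseteq> set xs" for A
    using that x finite_subset by blast+
  have "{A. A \<subseteq> set (x # xs) \<and> card A = Suc n} = insert x ` ?I n \<union> ?I (Suc n)" (is "?L = ?R")
  proof
    show "?L \<subseteq> ?R"
    proof
      fix A assume A: "A \<in> ?L"
      show "A \<in> ?R"
      proof (cases "x \<in> A")
        case True
        then have "A - {x} \<in> ?I n" "A = insert x (A - {x})"
          using A by auto
        then show ?thesis by blast
      next
        case False
        then show ?thesis using A by auto
      qed
    qed
    show "?R \<subseteq> ?L" using sub by auto
  qed
  then have "(\<Sum>A | A \<subseteq> set (x # xs) \<and> card A = Suc n. f A (set (x # xs) - A)) =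
      (\<Sum>A\<in>insert x ` ?I n. f A (insert x (set xs) - A)) +
      (\<Sum>A\<in>?I (Suc n). f A (insert x (set xs) - A))"
    using fin x by (subst sum.union_disjoint[symmetric]) auto
  also have "(\<Sum>A\<in>insert x ` ?I n. f A (insert x (set xs) - A)) =
      (\<Sum>A\<in>?I n. f (insert x A) (set xs - A))"
  proof (subst sum.reindex)
    show "inj_on (insert x) (?I n)"
      using x by (auto simp: inj_on_def)
    have "insert x (set xs) - insert x A = set xs - A" if "A \<in> ?I n" for A
      using x that by auto
    then show "sum ((\<lambda>A. f A (insert x (set xs) - A)) \<circ> insert x) (?I n) =
        (\<Sum>A\<in>?I n. f (insert x A) (set xs - A))"
      by (intro sum.cong) auto
  qed
  also have "(\<Sum>A\<in>?I (Suc n). f A (insert x (set xs) - A)) =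
      (\<Sum>A\<in>?I (Suc n). f A (insert x (set xs - A)))"
    using sub by (intro sum.cong) (auto simp: insert_Diff_if)
  finally show ?case
    using "3.IH"(1)[of "\<lambda>A. f (insert x A)"] "3.IH"(2)[of "\<lambda>A B. f A (insert x B)"] "3.prems"
    by (simp add: comp_def case_prod_unfold)
qed

lemma set_splits:
  assumes "(s, ys, zs) \<in> set (splits n xs)" "sorted_wrt (<) xs"
  shows "length ys = n \<and> length zs = length xs - n \<and> sorted_wrt (<) ys \<and> sorted_wrt (<) zs \<and>
    set ys \<union> set zs = set xs \<and> set ys \<inter> set zs = {} \<and> wedge_sign (set ys) (set zs) = sg s"
  using assms
proof (induction n xs arbitrary: s ys zs rule: splits.induct)
  case (3 n x xs)
  from "3.prems" consider
    (1) ys' where "ys = x # ys'" "(s, ys', zs) \<in> set (splits n xs)"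
  | (2) s' zs' where "zs = x # zs'" "s = (s' \<noteq> odd (Suc n))" "(s', ys, zs') \<in> set (splits (Suc n) xs)"
    by auto
  then show ?case
  proof cases
    case 1
    then have IH: "length ys' = n" "length zs = length xs - n" "sorted_wrt (<) ys'"
      "sorted_wrt (<) zs" "set ys' \<union> set zs = set xs" "set ys' \<inter> set zs = {}"
      "wedge_sign (set ys') (set zs) = sg s"
      using "3.IH"(1)[of s ys' zs] "3.prems" by auto
    have x: "x < a" if "a \<in> set ys' \<union> set zs" for a
      using that "3.prems" IH(5) by auto
    have "{(i, j). i \<in> {x} \<and> j \<in> set zs \<and> j < i} = {}" using x by force
    then have "wedge_sign {x} (set zs) = 1" by (simp only: wedge_sign_def card.empty power_0)
    moreover have "x \<notin> set ys'" "x \<notin> set zs" using x by blast+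
    ultimately have "wedge_sign (set ys) (set zs) = sg s"
      using wedge_sign_Un_left[of "{x}" "set ys'" "set zs"] IH 1 by simp
    then show ?thesis using IH 1 x \<open>x \<notin> set ys'\<close> \<open>x \<notin> set zs\<close> by auto
  next
    case 2
    then have IH: "length ys = Suc n" "length zs' = length xs - Suc n" "sorted_wrt (<) ys"
      "sorted_wrt (<) zs'" "set ys \<union> set zs' = set xs" "set ys \<inter> set zs' = {}"
      "wedge_sign (set ys) (set zs') = sg s'"
      using "3.IH"(2)[of s' ys zs'] "3.prems" by auto
    have x: "x < a" if "a \<in> set ys \<union> set zs'" for a
      using that "3.prems" IH(5) by auto
    \<comment> \<open>As \<open>x\<close> is the least element and goes to the second part, it forms
      an inversion with each of the \<open>Suc n\<close> entries of \<open>ys\<close>.\<close>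
    have "{(i, j). i \<in> set ys \<and> j \<in> {x} \<and> j < i} = set ys \<times> {x}" using x by force
    moreover have "card (set ys) = Suc n"
      using IH(1,3) by (metis distinct_card strict_sorted_iff)
    ultimately have "wedge_sign (set ys) {x} = (-1) ^ Suc n"
      by (simp only: wedge_sign_def card_cartesian_product) simp
    moreover have "x \<notin> set ys" "x \<notin> set zs'" using x by blast+
    \<comment> \<open>Natural subtraction: adding the head to \<open>zs'\<close> gives the claimed
      length only because \<open>Suc n\<close> does not exceed \<open>length xs\<close>, which
      follows by comparing cardinalities.\<close>
    moreover have "length zs = Suc (length xs) - Suc n"
    proof -
      have "card (set xs) = length xs" using "3.prems" by (metis distinct_card strict_sorted_iff sorted_wrt.simps(2))
      moreover have "card (set ys) \<le> card (set xs)" using IH(5) by (intro card_mono) auto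
      ultimately show ?thesis using \<open>card (set ys) = Suc n\<close> IH(2) 2 by simp
    qed
    ultimately have "wedge_sign (set ys) (set zs) = sg s"
      using wedge_sign_Un_right[of "{x}" "set zs'" "set ys"] IH 2 by (auto simp: minus_one_power_iff)
    then show ?thesis using IH 2 x \<open>x \<notin> set ys\<close> \<open>x \<notin> set zs'\<close> \<open>length zs = _\<close> by auto
  qed
qed (simp_all add: wedge_sign_empty)

lemma sum_list_cong: "(\<And>x. x \<in> set xs \<Longrightarrow> f x = g x) \<Longrightarrow> (\<Sum>x\<leftarrow>xs. f x) = (\<Sum>x\<leftarrow>xs. g x)"
  by (simp cong: map_cong)

text \<open>The bidegree of \<open>F\<close> fixes the sizes of the two left parts, so all other
  subsets drop out. The global sign is the one for moving the \<open>q\<close> left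
  \<open>DY\<close> factors past the \<open>length xs - p\<close> right \<open>DX\<close>
  factors.\<close>

lemma wedge_splits:
  assumes F: "bidegree p q F" and sorted: "sorted_wrt (<) xs" "sorted_wrt (<) ys"
  shows "(F \<and>\<^sub>O G) $ xy (set xs) (set ys) =
    (\<Sum>(s, a, a')\<leftarrow>splits p xs. \<Sum>(t, b, b')\<leftarrow>splits q ys.
      ((-1) ^ (q * (length xs - p)) * sg (s \<noteq> t)) *\<^sub>R (F $ xy (set a) (set b) \<bullet>\<^sub>O G $ xy (set a') (set b')))"
proof -
  let ?w = "\<lambda>A A' B B'. ((-1) ^ (card B * card A') * (wedge_sign A A' * wedge_sign B B')) *\<^sub>R
       (F $ xy A B \<bullet>\<^sub>O G $ xy A' B')"
  have dist: "distinct xs" "distinct ys" using sorted by (simp_all add: strict_sorted_iff)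
  have zero: "?w A A' B B' = 0" if "\<not> (card A = p \<and> card B = q)" for A A' B B'
    using bidegree_nth[OF F that] by (simp add: oct_mult_zero)
  have "(F \<and>\<^sub>O G) $ xy (set xs) (set ys) =
      (\<Sum>A\<in>Pow (set xs). \<Sum>B\<in>Pow (set ys). ?w A (set xs - A) B (set ys - B))"
    by (rule wedge_xy)
  also have "\<dots> = (\<Sum>A\<in>Pow (set xs). \<Sum>B | B \<subseteq> set ys \<and> card B = q. ?w A (set xs - A) B (set ys - B))"
    by (intro sum.cong refl sum.mono_neutral_right) (auto intro!: zero simp del: scaleR_eq_0_iff)
  also have "\<dots> = (\<Sum>A | A \<subseteq> set xs \<and> card A = p. \<Sum>B | B \<subseteq> set ys \<and> card B = q.
      ?w A (set xs - A) B (set ys - B))"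
    by (intro sum.mono_neutral_right) (auto intro!: sum.neutral zero simp del: scaleR_eq_0_iff)
  also have "\<dots> = (\<Sum>(s, a, a')\<leftarrow>splits p xs. \<Sum>(t, b, b')\<leftarrow>splits q ys.
      ?w (set a) (set a') (set b) (set b'))"
    unfolding sum_splits[OF dist(2), where f = "\<lambda>B B'. ?w _ _ B B'"]
    by (rule sum_splits[OF dist(1)])
  also have "\<dots> = (\<Sum>(s, a, a')\<leftarrow>splits p xs. \<Sum>(t, b, b')\<leftarrow>splits q ys.
      ((-1) ^ (q * (length xs - p)) * sg (s \<noteq> t)) *\<^sub>R (F $ xy (set a) (set b) \<bullet>\<^sub>O G $ xy (set a') (set b')))"
  proof (intro sum_list_cong, clarify, intro sum_list_cong, clarify)
    fix s a a' t b b'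
    assume "(s, a, a') \<in> set (splits p xs)" "(t, b, b') \<in> set (splits q ys)"
    from this[THEN set_splits] sorted
    have "wedge_sign (set a) (set a') = sg s" "wedge_sign (set b) (set b') = sg t"
      "card (set b) = q" "card (set a') = length xs - p"
      by (auto simp: strict_sorted_iff distinct_card)
    then show "?w (set a) (set a') (set b) (set b') = ((-1) ^ (q * (length xs - p)) * sg (s \<noteq> t)) *\<^sub>R
        (F $ xy (set a) (set b) \<bullet>\<^sub>O G $ xy (set a') (set b'))"
      by auto
  qed
  finally show ?thesis .
qed

section \<open>Coefficients as integer sums over signed units\<close>

fun unit_word :: "8 list \<Rightarrow> bool \<times> 8" where
  "unit_word [l, i, j, k] = unit_mult (unit_mult (unit_mult
     (unit_cnj (False, l)) (False, i)) (unit_cnj (False, j))) (False, k)"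
| "unit_word _ = undefined"

lemma unit_word: "unit (unit_word [l, i, j, k]) = oct_word l i j k"
  by (simp only: unit_word.simps oct_word_def unit_False unit_mult unit_cnj)

fun re_mult :: "bool \<times> 8 \<Rightarrow> bool \<times> 8 \<Rightarrow> int" where
  "re_mult (s, i) (t, j) = (if i = j then sg (s \<noteq> (t \<noteq> (i \<noteq> 0))) else 0)"

fun rinner_e :: "bool \<times> 8 \<Rightarrow> bool \<times> 8 \<Rightarrow> int" where
  "rinner_e (s, i) (t, j) = (if i = j then sg (s \<noteq> t) else 0)"

text \<open>The real part of a product is a bilinear expression free of the multiplication table.
  For signed units it is 0 or +-1, which \<open>re_mult\<close> and \<open>rinner_e\<close> record
  as integers.\<close>

lemma oct_mult_re: "(x \<bullet>\<^sub>O y) $ 0 = 2 * x $ 0 * y $ 0 - x \<bullet> y"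
  "(x \<bullet>\<^sub>O oct_cnj y) $ 0 = x \<bullet> y"
  by (simp_all add: oct_mult_nth oct_cnj_def inner_vec_def sum_8)

lemma re_mult: "(unit u \<bullet>\<^sub>O unit v) $ 0 = of_int (re_mult u v)"
  by (cases u; cases v) (auto simp: oct_mult_re e_nth inner_e)

lemma rinner_e: "(unit u \<bullet>\<^sub>O oct_cnj (unit v)) $ 0 = of_int (rinner_e u v)"
  by (cases u; cases v) (auto simp: oct_mult_re(2) inner_e)

definition coeff_8_0 :: "8 list \<Rightarrow> int" where
  "coeff_8_0 xs = (\<Sum>(s, a, a')\<leftarrow>splits 4 xs. sg s * rinner_e (unit_word a) (unit_word a'))"

text \<open>The solitary index in \<open>b\<close> leads each word, as in \<open>oct_word\<close>.
  The same sum serves \<open>Psi31\<close> and \<open>Psi13\<close>, whose coefficients differ only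
  in the roles of the two kinds of coordinates and a sign.\<close>

definition coeff_6_2 :: "8 list \<Rightarrow> 8 list \<Rightarrow> int" where
  "coeff_6_2 xs ys = (\<Sum>(s, a, a')\<leftarrow>splits 3 xs. \<Sum>(t, b, b')\<leftarrow>splits 1 ys.
     sg (s \<noteq> t) * rinner_e (unit_word (b @ a)) (unit_word (b' @ a')))"

text \<open>In the second word the solitary index is the \<open>dx\<close> index, hence
  \<open>a' @ b'\<close>; the second factor is not conjugated, hence \<open>re_mult\<close>.\<close>

definition coeff_4_4 :: "8 list \<Rightarrow> 8 list \<Rightarrow> int" where
  "coeff_4_4 xs ys = (\<Sum>(s, a, a')\<leftarrow>splits 3 xs. \<Sum>(t, b, b')\<leftarrow>splits 1 ys.
     sg (s \<noteq> t) * re_mult (unit_word (b @ a)) (unit_word (a' @ b')))"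

lemma sum_list_nth: "(\<Sum>x\<leftarrow>xs. f x) $ i = (\<Sum>x\<leftarrow>xs. f x $ i)"
  by (induction xs) simp_all

lemma length_3E:
  assumes "length xs = 3" obtains a b c where "xs = [a, b, c]"
  using assms by (auto simp: length_Suc_conv numeral_eq_Suc)

lemma length_4E:
  assumes "length xs = 4" obtains a b c d where "xs = [a, b, c, d]"
  using assms by (auto simp: length_Suc_conv numeral_eq_Suc)

lemma length_1E:
  assumes "length xs = 1" obtains a where "xs = [a]"
  using assms by (auto simp: length_Suc_conv)

lemma Psi_nth_unit:
  assumes "sorted_wrt (<) a"
  shows "length a = 3 \<Longrightarrow> length b = 1 \<Longrightarrow> Psi31 $ xy (set a) (set b) = (-6) *\<^sub>R unit (unit_word (b @ a))"
    and "length a = 3 \<Longrightarrow> length b = 1 \<Longrightarrow> Psi13 $ xy (set b) (set a) = 6 *\<^sub>R unit (unit_word (b @ a))"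
    and "length a = 4 \<Longrightarrow> Psi40 $ xy (set a) {} = 24 *\<^sub>R unit (unit_word a)"
    and "length a = 4 \<Longrightarrow> Psi04 $ xy {} (set a) = 24 *\<^sub>R unit (unit_word a)"
proof -
  assume "length a = 3" "length b = 1"
  then obtain i j k l where ab: "a = [i, j, k]" "b = [l]"
    by (metis length_3E length_1E)
  have ijk: "i < j" "j < k" using assms by (auto simp: ab)
  show "Psi31 $ xy (set a) (set b) = (-6) *\<^sub>R unit (unit_word (b @ a))"
    by (simp only: Psi31_nth[OF ijk] ab append.simps unit_word list.set)
  show "Psi13 $ xy (set b) (set a) = 6 *\<^sub>R unit (unit_word (b @ a))"
    by (simp only: Psi13_nth[OF ijk] ab append.simps unit_word list.set)
next
  assume "length a = 4"
  then obtain i j k l where ab: "a = [i, j, k, l]"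
    by (rule length_4E)
  have ijk: "i < j" "j < k" "k < l" using assms by (auto simp: ab)
  show "Psi40 $ xy (set a) {} = 24 *\<^sub>R unit (unit_word a)"
    by (simp only: Psi40_nth[OF ijk] ab append.simps unit_word list.set)
  show "Psi04 $ xy {} (set a) = 24 *\<^sub>R unit (unit_word a)"
    by (simp only: Psi04_nth[OF ijk] ab append.simps unit_word list.set)
qed

lemma of_int_sum_list: "of_int (\<Sum>x\<leftarrow>xs. f x) = (\<Sum>x\<leftarrow>xs. of_int (f x))"
  by (induction xs) simp_all

lemma sum_list_minus: "(\<Sum>x\<leftarrow>xs. - f x) = - (\<Sum>x\<leftarrow>xs. f x)"
  for f :: "'a \<Rightarrow> 'b::ab_group_add"
  by (induction xs) simp_all

lemma sum_list_swap:
  "(\<Sum>x\<leftarrow>xs. \<Sum>y\<leftarrow>ys. f x y) = (\<Sum>y\<leftarrow>ys. \<Sum>x\<leftarrow>xs. f x y)"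
  for f :: "'a \<Rightarrow> 'b \<Rightarrow> 'c::comm_monoid_add"
  by (induction xs) (simp_all add: sum_list_addf)

context
  fixes xs ys :: "8 list"
  assumes sorted: "sorted_wrt (<) xs" "sorted_wrt (<) ys"
begin

lemma Psi40_Psi40_nth:
  assumes "length xs = 8"
  shows "(Psi40 \<and>\<^sub>O form_cnj Psi40) $ xy (set xs) {} $ 0 = 576 * of_int (coeff_8_0 xs)"
proof -
  \<comment> \<open>The empty set is treated as \<open>set []\<close>, the form in which
    \<open>wedge_splits\<close> takes its index sets.\<close>
  have nil: "sorted_wrt (<) ([] :: 8 list)" by simp
  have "(Psi40 \<and>\<^sub>O form_cnj Psi40) $ xy (set xs) (set []) $ 0 =
      (\<Sum>(s, a, a')\<leftarrow>splits 4 xs. 576 * of_int (sg s * rinner_e (unit_word a) (unit_word a')))"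
    unfolding wedge_splits[OF bidegree_Psi(1) sorted(1) nil] sum_list_nth
  proof (intro sum_list_cong, clarify)
    fix s a a' assume "(s, a, a') \<in> set (splits 4 xs)"
    from set_splits[OF this sorted(1)] assms have
      "length a = 4" "length a' = 4" "sorted_wrt (<) a" "sorted_wrt (<) a'" by auto
    from Psi_nth_unit(3)[OF this(3,1)] Psi_nth_unit(3)[OF this(4,2)]
    show "(\<Sum>(t, b, b')\<leftarrow>splits 0 []. ((- 1) ^ (0 * (length xs - 4)) * sg (s \<noteq> t)) *\<^sub>R
        (Psi40 $ xy (set a) (set b) \<bullet>\<^sub>O form_cnj Psi40 $ xy (set a') (set b'))) $ 0 =
        576 * of_int (sg s * rinner_e (unit_word a) (unit_word a'))"
      by (simp add: form_cnj_nth oct_cnj_linear oct_mult_scaleR rinner_e)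
  qed
  then show ?thesis
    by (simp add: coeff_8_0_def sum_list_const_mult case_prod_unfold of_int_sum_list sum_list_minus)
qed

lemma Psi04_Psi04_nth:
  assumes "length ys = 8"
  shows "(Psi04 \<and>\<^sub>O form_cnj Psi04) $ xy {} (set ys) $ 0 = 576 * of_int (coeff_8_0 ys)"
proof -
  have nil: "sorted_wrt (<) ([] :: 8 list)" by simp
  have "(Psi04 \<and>\<^sub>O form_cnj Psi04) $ xy (set []) (set ys) $ 0 =
      (\<Sum>(s, a, a')\<leftarrow>splits 4 ys. 576 * of_int (sg s * rinner_e (unit_word a) (unit_word a')))"
    unfolding wedge_splits[OF bidegree_Psi(4) nil sorted(2)] splits.simps list.map
      sum_list_nth prod.case sum_list.Cons sum_list.Nil add_0_right
  proof (intro sum_list_cong, clarify)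
    fix s a a' assume "(s, a, a') \<in> set (splits 4 ys)"
    from set_splits[OF this sorted(2)] assms have
      "length a = 4" "length a' = 4" "sorted_wrt (<) a" "sorted_wrt (<) a'" by auto
    from Psi_nth_unit(4)[OF this(3,1)] Psi_nth_unit(4)[OF this(4,2)]
    show "(((- 1) ^ (4 * (length ([] :: 8 list) - 0)) * sg (False \<noteq> s)) *\<^sub>R
        (Psi04 $ xy (set []) (set a) \<bullet>\<^sub>O form_cnj Psi04 $ xy (set []) (set a'))) $ 0 =
        576 * of_int (sg s * rinner_e (unit_word a) (unit_word a'))"
      by (simp add: form_cnj_nth oct_cnj_linear oct_mult_scaleR rinner_e)
  qed
  then show ?thesis
    by (simp add: coeff_8_0_def sum_list_const_mult case_prod_unfold of_int_sum_list sum_list_minus)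
qed

text \<open>The factor is \<open>(-6) * (-6)\<close> times the sign \<open>(-1) ^ (1 * 3)\<close>
  from \<open>wedge_splits\<close>.\<close>

lemma Psi31_Psi31_nth:
  assumes "length xs = 6" "length ys = 2"
  shows "(Psi31 \<and>\<^sub>O form_cnj Psi31) $ xy (set xs) (set ys) $ 0 = - 36 * of_int (coeff_6_2 xs ys)"
proof -
  have "(Psi31 \<and>\<^sub>O form_cnj Psi31) $ xy (set xs) (set ys) $ 0 =
      (\<Sum>(s, a, a')\<leftarrow>splits 3 xs. \<Sum>(t, b, b')\<leftarrow>splits 1 ys.
        - 36 * of_int (sg (s \<noteq> t) * rinner_e (unit_word (b @ a)) (unit_word (b' @ a'))))"
    unfolding wedge_splits[OF bidegree_Psi(2) sorted] sum_list_nth case_prod_unfold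
  proof (intro sum_list_cong, goal_cases)
    case (1 u v)
    obtain s a a' t b b' where [simp]: "u = (s, a, a')" "v = (t, b, b')" by (metis prod_cases3)
    from set_splits[OF 1(1)[simplified] sorted(1)] set_splits[OF 1(2)[simplified] sorted(2)] assms have
      "length a = 3" "length a' = 3" "length b = 1" "length b' = 1"
      "sorted_wrt (<) a" "sorted_wrt (<) a'" by auto
    from Psi_nth_unit(1)[OF this(5,1,3)] Psi_nth_unit(1)[OF this(6,2,4)]
    show ?case
      by (simp add: form_cnj_nth oct_cnj_linear oct_mult_scaleR oct_mult_minus rinner_e assms)
  qed
  then show ?thesis
    by (simp add: coeff_6_2_def sum_list_const_mult case_prod_unfold of_int_sum_list sum_list_minus)
qed

text \<open>The factor is \<open>6 * 6\<close> times the sign \<open>(-1) ^ (3 * 1)\<close>;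
  exchanging the two sums then recovers \<open>coeff_6_2\<close>.\<close>

lemma Psi13_Psi13_nth:
  assumes "length xs = 6" "length ys = 2"
  shows "(Psi13 \<and>\<^sub>O form_cnj Psi13) $ xy (set ys) (set xs) $ 0 = - 36 * of_int (coeff_6_2 xs ys)"
proof -
  have "(Psi13 \<and>\<^sub>O form_cnj Psi13) $ xy (set ys) (set xs) $ 0 =
      (\<Sum>(t, b, b')\<leftarrow>splits 1 ys. \<Sum>(s, a, a')\<leftarrow>splits 3 xs.
        - 36 * of_int (sg (s \<noteq> t) * rinner_e (unit_word (b @ a)) (unit_word (b' @ a'))))"
    unfolding wedge_splits[OF bidegree_Psi(3) sorted(2,1)] sum_list_nth case_prod_unfold
  proof (intro sum_list_cong, goal_cases)
    case (1 v u)
    obtain s a a' t b b' where [simp]: "u = (s, a, a')" "v = (t, b, b')" by (metis prod_cases3)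
    from set_splits[OF 1(2)[simplified] sorted(1)] set_splits[OF 1(1)[simplified] sorted(2)] assms have
      "length a = 3" "length a' = 3" "length b = 1" "length b' = 1"
      "sorted_wrt (<) a" "sorted_wrt (<) a'" by auto
    from Psi_nth_unit(2)[OF this(5,1,3)] Psi_nth_unit(2)[OF this(6,2,4)]
    show ?case
      by (simp add: form_cnj_nth oct_cnj_linear oct_mult_scaleR oct_mult_minus rinner_e assms)
  qed
  also have "\<dots> = (\<Sum>(s, a, a')\<leftarrow>splits 3 xs. \<Sum>(t, b, b')\<leftarrow>splits 1 ys.
        - 36 * of_int (sg (s \<noteq> t) * rinner_e (unit_word (b @ a)) (unit_word (b' @ a'))))"
    unfolding case_prod_unfold by (rule sum_list_swap)
  finally show ?thesis
    by (simp add: coeff_6_2_def sum_list_const_mult case_prod_unfold of_int_sum_list sum_list_minus)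
qed

text \<open>The minus sign in \<open>(-6) * 6\<close> cancels against
  \<open>(-1) ^ (1 * 1)\<close>.\<close>

lemma Psi31_Psi13_nth:
  assumes "length xs = 4" "length ys = 4"
  shows "(Psi31 \<and>\<^sub>O Psi13) $ xy (set xs) (set ys) $ 0 = 36 * of_int (coeff_4_4 xs ys)"
proof -
  have "(Psi31 \<and>\<^sub>O Psi13) $ xy (set xs) (set ys) $ 0 =
      (\<Sum>(s, a, a')\<leftarrow>splits 3 xs. \<Sum>(t, b, b')\<leftarrow>splits 1 ys.
        36 * of_int (sg (s \<noteq> t) * re_mult (unit_word (b @ a)) (unit_word (a' @ b'))))"
    unfolding wedge_splits[OF bidegree_Psi(2) sorted] sum_list_nth case_prod_unfold
  proof (intro sum_list_cong, goal_cases)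
    case (1 u v)
    obtain s a a' t b b' where [simp]: "u = (s, a, a')" "v = (t, b, b')" by (metis prod_cases3)
    from set_splits[OF 1(1)[simplified] sorted(1)] set_splits[OF 1(2)[simplified] sorted(2)] assms have
      "length a = 3" "length a' = 1" "length b = 1" "length b' = 3"
      "sorted_wrt (<) a" "sorted_wrt (<) b'" by auto
    from Psi_nth_unit(1)[OF this(5,1,3)] Psi_nth_unit(2)[OF this(6,4,2)]
    show ?case
      by (simp add: oct_mult_scaleR oct_mult_minus re_mult assms)
  qed
  then show ?thesis
    by (simp add: coeff_4_4_def sum_list_const_mult case_prod_unfold of_int_sum_list sum_list_minus)
qed

end

section \<open>Reality, grading and bidegrees of the eight-form\<close>

lemma form_cnj_add: "form_cnj (F + G) = form_cnj F + form_cnj G"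
  "form_cnj (F - G) = form_cnj F - form_cnj G" "form_cnj (a *\<^sub>R F) = a *\<^sub>R form_cnj F"
  by (simp_all add: form_cnj_def oct_cnj_linear vec_eq_iff)

lemma even_form_cnj: "even_form F \<Longrightarrow> even_form (form_cnj F)"
  by (simp add: even_form_def form_cnj_nth oct_cnj_linear)

text \<open>The four-forms have even degree, so conjugation reverses products without a sign: each
  product of a form with its conjugate is fixed, and the two mixed terms are exchanged.\<close>

lemma form_cnj_Psi8: "form_cnj Psi8 = Psi8"
  unfolding Psi8_def
  by (simp add: form_cnj_add form_cnj_wedge even_Psi even_form_cnj form_cnj_cnj add.commute)

lemma Psi8_imaginary:
  assumes "k \<noteq> 0" shows "Psi8 $ S $ k = 0"
proof -
  have "Psi8 $ S = oct_cnj (Psi8 $ S)"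
    using form_cnj_nth[of Psi8 S] by (simp add: form_cnj_Psi8)
  then have "Psi8 $ S $ k = oct_cnj (Psi8 $ S) $ k" by (rule arg_cong)
  also have "\<dots> = - Psi8 $ S $ k" using assms by (simp add: oct_cnj_def)
  finally show ?thesis by simp
qed

lemma graded_Psi8: "graded Psi8"
  unfolding Psi8_def
  by (intro graded_add graded_diff graded_scaleR graded_wedge graded_form_cnj graded_Psi)

lemma Psi8_ungraded:
  assumes "index_prod (\<lambda>i. i) A \<noteq> index_prod (\<lambda>i. i) B"
  shows "Psi8 $ xy A B $ 0 = 0"
proof -
  have "index_prod (\<lambda>i. i) A \<odot> index_prod (\<lambda>i. i) B \<noteq> 0"
    using assms index_mult_eq_iff[of _ _ 0] by (auto simp: index_mult_0)
  then have "0 \<noteq> index_prod coord_index (xy A B)"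
    unfolding index_prod_xy by (rule not_sym)
  then show ?thesis using graded_Psi8 unfolding graded_def by blast
qed

text \<open>The summands have five distinct bidegrees, so at most one of them contributes. The
  factor -10 is twice -5, because the two mixed terms are conjugate and share their real
  part.\<close>

lemma Psi8_nth:
  "Psi8 $ xy A B $ 0 =
    (if card A = 8 \<and> card B = 0 then (Psi40 \<and>\<^sub>O form_cnj Psi40) $ xy A B $ 0
     else if card A = 6 \<and> card B = 2 then 4 * (Psi31 \<and>\<^sub>O form_cnj Psi31) $ xy A B $ 0
     else if card A = 4 \<and> card B = 4 then - 10 * (Psi31 \<and>\<^sub>O Psi13) $ xy A B $ 0
     else if card A = 2 \<and> card B = 6 then 4 * (Psi13 \<and>\<^sub>O form_cnj Psi13) $ xy A B $ 0
     else if card A = 0 \<and> card B = 8 then (Psi04 \<and>\<^sub>O form_cnj Psi04) $ xy A B $ 0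
     else 0)"
proof -
  note D = bidegree_wedge bidegree_form_cnj bidegree_Psi
  have "bidegree (4+4) (0+0) (Psi40 \<and>\<^sub>O form_cnj Psi40)" by (intro D)
  from bidegree_nth[OF this] have 1:
    "\<not> (card A = 8 \<and> card B = 0) \<Longrightarrow> (Psi40 \<and>\<^sub>O form_cnj Psi40) $ xy A B = 0" by (simp add: numeral_eq_Suc)
  have "bidegree (3+3) (1+1) (Psi31 \<and>\<^sub>O form_cnj Psi31)" by (intro D)
  from bidegree_nth[OF this] have 2:
    "\<not> (card A = 6 \<and> card B = 2) \<Longrightarrow> (Psi31 \<and>\<^sub>O form_cnj Psi31) $ xy A B = 0" by (simp add: numeral_eq_Suc)
  have "bidegree (3+1) (1+3) (Psi31 \<and>\<^sub>O Psi13)" by (intro D)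
  from bidegree_nth[OF this] have 3:
    "\<not> (card A = 4 \<and> card B = 4) \<Longrightarrow> (Psi31 \<and>\<^sub>O Psi13) $ xy A B = 0" by (simp add: numeral_eq_Suc)
  have "bidegree (1+1) (3+3) (Psi13 \<and>\<^sub>O form_cnj Psi13)" by (intro D)
  from bidegree_nth[OF this] have 4:
    "\<not> (card A = 2 \<and> card B = 6) \<Longrightarrow> (Psi13 \<and>\<^sub>O form_cnj Psi13) $ xy A B = 0" by (simp add: numeral_eq_Suc)
  have "bidegree (0+0) (4+4) (Psi04 \<and>\<^sub>O form_cnj Psi04)" by (intro D)
  from bidegree_nth[OF this] have 5:
    "\<not> (card A = 0 \<and> card B = 8) \<Longrightarrow> (Psi04 \<and>\<^sub>O form_cnj Psi04) $ xy A B = 0" by (simp add: numeral_eq_Suc)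
  have "form_cnj Psi13 \<and>\<^sub>O form_cnj Psi31 = form_cnj (Psi31 \<and>\<^sub>O Psi13)"
    by (simp add: form_cnj_wedge even_Psi)
  then have 6: "(form_cnj Psi13 \<and>\<^sub>O form_cnj Psi31) $ xy A B $ 0 = (Psi31 \<and>\<^sub>O Psi13) $ xy A B $ 0"
    by (simp add: form_cnj_nth oct_cnj_def)
  have eq: "Psi8 $ xy A B $ 0 = (Psi40 \<and>\<^sub>O form_cnj Psi40) $ xy A B $ 0
      + 4 * (Psi31 \<and>\<^sub>O form_cnj Psi31) $ xy A B $ 0 - 10 * (Psi31 \<and>\<^sub>O Psi13) $ xy A B $ 0
      + 4 * (Psi13 \<and>\<^sub>O form_cnj Psi13) $ xy A B $ 0 + (Psi04 \<and>\<^sub>O form_cnj Psi04) $ xy A B $ 0"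
    by (simp add: Psi8_def 6)
  consider "card A = 8 \<and> card B = 0" | "card A = 6 \<and> card B = 2" | "card A = 4 \<and> card B = 4"
    | "card A = 2 \<and> card B = 6" | "card A = 0 \<and> card B = 8"
    | "\<not> (card A = 8 \<and> card B = 0)" "\<not> (card A = 6 \<and> card B = 2)" "\<not> (card A = 4 \<and> card B = 4)"
      "\<not> (card A = 2 \<and> card B = 6)" "\<not> (card A = 0 \<and> card B = 8)"
    by blast
  then show ?thesis
    unfolding eq by cases (auto simp add: 1 2 3 4 5 simp del: card_0_eq)
qed

section \<open>Evaluation\<close>

text \<open>The recursion of \<open>splits\<close> in terms of numerals; \<open>1\<close> is not
  syntactically of the form \<open>numeral k\<close> and gets its own rules.\<close>

lemma splits_numeral:
  "splits (numeral k) [] = []"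
  "splits (numeral k) (x # xs) =
    map (\<lambda>(s, ys, zs). (s, x # ys, zs)) (splits (pred_numeral k) xs) @
    map (\<lambda>(s, ys, zs). (s \<noteq> odd (numeral k :: nat), ys, x # zs)) (splits (numeral k) xs)"
  "splits 1 [] = []"
  "splits 1 (x # xs) =
    (False, [x], xs) # map (\<lambda>(s, ys, zs). (\<not> s, ys, x # zs)) (splits 1 xs)"
  using splits.simps(2,3)[of "pred_numeral k"] splits.simps(2,3)[of 0]
  by (simp_all del: splits.simps(2,3) flip: numeral_eq_Suc)

primrec index_list :: "8 list \<Rightarrow> 8" where
  "index_list [] = 0"
| "index_list (x # xs) = x \<odot> index_list xs"

abbreviation octs :: "8 list" where "octs \<equiv> [0, 1, 2, 3, 4, 5, 6, 7]"

lemma parity_numerals: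
  "odd (1::nat)" "even (2::nat)" "odd (3::nat)" "even (4::nat)" "odd (5::nat)" "even (6::nat)"
  by simp_all

lemmas splits_eval = splits.simps(1) splits_numeral pred_numeral_simps BitM.simps parity_numerals
  One_nat_def[symmetric] list.map append.simps prod.case simp_thms if_True if_False numeral_One

lemmas signs_eval = index_mult_table oct_neg_table index_list.simps neq_8 list.inject list.distinct
  unit_word.simps(1) unit_mult.simps unit_cnj.simps re_mult.simps rinner_e.simps
  simp_thms if_True if_False prod.case list.map sum_list.Cons sum_list.Nil append.simps
  mult_1_left mult_minus_left add_0_right minus_minus list.pred_inject
  arith_simps arith_special sub_num_simps Num.inc.simps Num.dbl_simps Num.dbl_inc_simps
  Num.dbl_dec_simps diff_0 rel_simps numeral_One abs_numeral abs_neg_numeral abs_one abs_zero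

\<comment> \<open>The 16 summands are expanded once for symbolic indices, so that the table below
  only has to instantiate and evaluate them.\<close>
schematic_goal coeff_4_4_eval: "coeff_4_4 [i0, i1, i2, i3] [j0, j1, j2, j3] = ?c"
  by (simp only: coeff_4_4_def splits_eval sum_list.Cons sum_list.Nil add_0_right mult_1_left
      mult_minus1)

schematic_goal coeff_6_2_eval: "coeff_6_2 [i0, i1, i2, i3, i4, i5] [j0, j1] = ?c"
  by (simp only: coeff_6_2_def splits_eval sum_list.Cons sum_list.Nil add_0_right mult_1_left
      mult_minus1)

text \<open>There are 70 summands of absolute value at most 1, so each of them equals 1.\<close>

lemma coeff_8_0_octs: "coeff_8_0 octs = 70"
  by (simp only: coeff_8_0_def splits_eval signs_eval)

text \<open>For equal index products all 16 summands are +-1, and the three values reflect how far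
  they cancel. Under \<open>if_weak_cong\<close> the condition is decided first, so sums are
  evaluated only for pairs with equal index products.\<close>

lemma coeff_4_4_table:
  "list_all (\<lambda>(s, a, a'). list_all (\<lambda>(t, b, b').
     if index_list a = index_list b then
       if index_list a = 0 then
         if b = a \<or> b = a' then \<bar>coeff_4_4 a b\<bar> = 16 else coeff_4_4 a b = 0
       else \<bar>coeff_4_4 a b\<bar> = 8
     else True) (splits 4 octs)) (splits 4 octs)"
  by (simp only: splits_eval, simp only: signs_eval coeff_4_4_eval cong: if_weak_cong)

text \<open>The value 40 = 20 * 2 is the number of summands: all of them have the same sign.\<close>

lemma coeff_6_2_table:
  "list_all (\<lambda>(s, a, a'). list_all (\<lambda>(t, b, b').
     if index_list a = index_list b then \<bar>coeff_6_2 a b\<bar> = 40 else True)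
     (splits 2 octs)) (splits 6 octs)"
  by (simp only: splits_eval, simp only: signs_eval coeff_6_2_eval cong: if_weak_cong)

lemma sorted_octs: "sorted_wrt (<) octs"
  by (simp add: less_bit0_def bit0.Rep_numeral bit0.Rep_0 bit0.Rep_1)

lemma set_octs: "set octs = UNIV"
  by (simp only: UNIV_8 list.set)

lemma index_prod_set: "distinct xs \<Longrightarrow> index_prod (\<lambda>i. i) (set xs) = index_list xs"
  by (induction xs) simp_all

text \<open>That the enumeration misses no subset is read off from \<open>sum_splits\<close>,
  applied to the indicator of \<open>A\<close>: if \<open>A\<close> were missing, the list sum would
  vanish while the sum over subsets does not.\<close>

lemma splits_exhaust:
  assumes "card A = n"
  obtains s a a' where "(s, a, a') \<in> set (splits n octs)"
    "A = set a" "- A = set a'" "sorted_wrt (<) a" "sorted_wrt (<) a'" "length a = n"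
    "index_prod (\<lambda>i. i) A = index_list a"
proof -
  have "\<exists>(s, a, a') \<in> set (splits n octs). set a = A"
  proof (rule ccontr)
    assume "\<not> ?thesis"
    then have "(\<Sum>(s, a, a')\<leftarrow>splits n octs. of_bool (set a = A)) = (0 :: nat)"
      by (auto simp: sum_list_eq_0_iff)
    then have "(\<Sum>X | X \<subseteq> set octs \<and> card X = n. of_bool (X = A)) = (0 :: nat)"
      using sum_splits[where f = "\<lambda>X Y. of_bool (X = A) :: nat", of octs n] sorted_octs
      by (simp only: strict_sorted_iff)
    then show False using assms unfolding set_octs by (simp add: sum_eq_0_iff)
  qed
  then obtain s a a' where a: "(s, a, a') \<in> set (splits n octs)" "set a = A" by auto
  from set_splits[OF a(1) sorted_octs] a(2)
  have "length a = n" "sorted_wrt (<) a" "sorted_wrt (<) a'" "A \<union> set a' = UNIV" "A \<inter> set a' = {}"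
    unfolding set_octs by auto
  moreover from this(4,5) have "- A = set a'" by auto
  moreover have "index_prod (\<lambda>i. i) A = index_list a"
    using index_prod_set[of a] \<open>sorted_wrt (<) a\<close> a(2) by (simp add: strict_sorted_iff)
  ultimately show thesis using that a by blast
qed

section \<open>The normalised coefficients\<close>

abbreviation set_index :: "8 set \<Rightarrow> 8" where "set_index \<equiv> index_prod (\<lambda>i. i)"

definition Psi8_coeff :: "8 set \<times> 8 set \<Rightarrow> real" where
  "Psi8_coeff = (\<lambda>(A, B). - 1 / (4 * fact 6) * Psi8 $ xy A B $ 0)"

lemma Psi8_coeff_eq: "Psi8_coeff (A, B) = - (Psi8 $ xy A B $ 0) / 2880"
  by (simp add: Psi8_coeff_def fact_numeral)

lemma Psi8_coeff_ungraded: "set_index A \<noteq> set_index B \<Longrightarrow> Psi8_coeff (A, B) = 0"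
  by (simp add: Psi8_coeff_eq Psi8_ungraded)

lemma Psi8_coeff_bidegree:
  assumes "(card A, card B) \<notin> {(8, 0), (6, 2), (4, 4), (2, 6), (0, 8)}"
  shows "Psi8_coeff (A, B) = 0"
  using assms unfolding Psi8_coeff_eq Psi8_nth by (auto simp del: card_0_eq)

lemma Psi8_coeff_8_0: "Psi8_coeff (UNIV, {}) = - 14" "Psi8_coeff ({}, UNIV) = - 14"
proof -
  have nil: "sorted_wrt (<) ([] :: 8 list)" by simp
  show "Psi8_coeff (UNIV, {}) = - 14" "Psi8_coeff ({}, UNIV) = - 14"
    using Psi40_Psi40_nth[OF sorted_octs nil] Psi04_Psi04_nth[OF nil sorted_octs]
    unfolding coeff_8_0_octs set_octs Psi8_coeff_eq Psi8_nth by simp_all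
qed

lemma Psi8_coeff_6_2:
  assumes "card A = 6" "card B = 2" "set_index A = set_index B"
  shows "\<bar>Psi8_coeff (A, B)\<bar> = 2" "\<bar>Psi8_coeff (B, A)\<bar> = 2"
proof -
  obtain s a a' where a: "(s, a, a') \<in> set (splits 6 octs)"
    "A = set a" "sorted_wrt (<) a" "length a = 6" "set_index A = index_list a"
    using splits_exhaust[OF assms(1)] by metis
  obtain t b b' where b: "(t, b, b') \<in> set (splits 2 octs)"
    "B = set b" "sorted_wrt (<) b" "length b = 2" "set_index B = index_list b"
    using splits_exhaust[OF assms(2)] by metis
  have "\<bar>coeff_6_2 a b\<bar> = 40"
    using coeff_6_2_table a b assms(3) unfolding list_all_iff by fastforce
  then have "\<bar>real_of_int (coeff_6_2 a b)\<bar> = 40" by linarith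
  \<comment> \<open>The minus sign of the normalisation cancels against the factor -36.\<close>
  moreover have "Psi8_coeff (A, B) = of_int (coeff_6_2 a b) / 20"
    using Psi31_Psi31_nth[OF a(3) b(3) a(4) b(4)] assms(1,2)
    unfolding Psi8_coeff_eq Psi8_nth a(2) b(2) by simp
  moreover have "Psi8_coeff (B, A) = of_int (coeff_6_2 a b) / 20"
    using Psi13_Psi13_nth[OF a(3) b(3) a(4) b(4)] assms(1,2)
    unfolding Psi8_coeff_eq Psi8_nth a(2) b(2) by simp
  ultimately show "\<bar>Psi8_coeff (A, B)\<bar> = 2" "\<bar>Psi8_coeff (B, A)\<bar> = 2" by simp_all
qed

lemma Psi8_coeff_4_4:
  assumes "card A = 4" "card B = 4" "set_index A = set_index B"
  shows "\<bar>Psi8_coeff (A, B)\<bar> = (if set_index A \<noteq> 0 then 1 else if B = A \<or> B = - A then 2 else 0)"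
proof -
  obtain s a a' where a: "(s, a, a') \<in> set (splits 4 octs)"
    "A = set a" "- A = set a'" "sorted_wrt (<) a" "sorted_wrt (<) a'" "length a = 4" "set_index A = index_list a"
    using splits_exhaust[OF assms(1)] by metis
  obtain t b b' where b: "(t, b, b') \<in> set (splits 4 octs)"
    "B = set b" "sorted_wrt (<) b" "length b = 4" "set_index B = index_list b"
    using splits_exhaust[OF assms(2)] by metis
  \<comment> \<open>A strictly increasing list is determined by its set, so the list comparisons in
    the table are comparisons of sets.\<close>
  have eq: "b = a \<longleftrightarrow> B = A" "b = a' \<longleftrightarrow> B = - A"
    using strict_sorted_equal a b by metis+
  have "if index_list a = 0 then
         if b = a \<or> b = a' then \<bar>coeff_4_4 a b\<bar> = 16 else coeff_4_4 a b = 0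
       else \<bar>coeff_4_4 a b\<bar> = 8"
    using coeff_4_4_table a(1,7) b(1,5) assms(3) unfolding list_all_iff by fastforce
  then have "\<bar>coeff_4_4 a b\<bar> = (if set_index A \<noteq> 0 then 8 else if B = A \<or> B = - A then 16 else 0)"
    unfolding eq a(7) by (auto split: if_splits)
  then have "\<bar>real_of_int (coeff_4_4 a b)\<bar> =
      real_of_int (if set_index A \<noteq> 0 then 8 else if B = A \<or> B = - A then 16 else 0)"
    by (simp only: of_int_abs[symmetric])
  \<comment> \<open>The minus sign of the normalisation cancels against the factor -10.\<close>
  moreover have "Psi8_coeff (A, B) = of_int (coeff_4_4 a b) / 8"
    using Psi31_Psi13_nth[OF a(4) b(3) a(6) b(4)] assms(1,2)
    unfolding Psi8_coeff_eq Psi8_nth a(2) b(2) by simp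
  then have "\<bar>Psi8_coeff (A, B)\<bar> = \<bar>real_of_int (coeff_4_4 a b)\<bar> / 8" by simp
  ultimately have "\<bar>Psi8_coeff (A, B)\<bar> =
      real_of_int (if set_index A \<noteq> 0 then 8 else if B = A \<or> B = - A then 16 else 0) / 8"
    by (simp only:)
  also have "\<dots> = (if set_index A \<noteq> 0 then 1 else if B = A \<or> B = - A then 2 else 0)" by simp
  finally show ?thesis .
qed

lemma Psi8_expansion:
  "(- 1 / (4 * fact 6)) *\<^sub>R Psi8 = real_form (\<Sum>t\<in>UNIV. Psi8_coeff t *\<^sub>R monomial t)"
proof -
  define \<phi> where "\<phi> = (\<chi> S. - 1 / (4 * fact 6) * Psi8 $ S $ 0)"
  have "(- 1 / (4 * fact 6)) *\<^sub>R Psi8 = real_form \<phi>"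
    unfolding vec_eq_iff
  proof (intro allI)
    fix S k
    show "((- 1 / (4 * fact 6)) *\<^sub>R Psi8) $ S $ k = real_form \<phi> $ S $ k"
      using Psi8_imaginary[of k S]
      by (cases "k = 0") (simp_all add: real_form_def tensor_def \<phi>_def e_nth)
  qed
  also have "\<phi> = (\<Sum>t\<in>UNIV. Psi8_coeff t *\<^sub>R monomial t)"
    using form_expansion[of \<phi>] by (simp add: Psi8_coeff_def \<phi>_def case_prod_unfold)
  finally show ?thesis .
qed

section \<open>The classes\<close>

lemmas index_mult_simps = index_mult_assoc index_mult_commute index_mult_left_commute
  index_mult_self index_mult_cancel index_mult_0

definition null_quads :: "8 set set" where "null_quads = {C. card C = 4 \<and> set_index C = 0}"
definition nonnull_quads :: "8 set set" where "nonnull_quads = {C. card C = 4 \<and> set_index C \<noteq> 0}"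

lemma card_compl_8: "card (- A) = 8 - card A" for A :: "8 set"
  by (simp add: card_Diff_subset Compl_eq_Diff_UNIV)

lemma set_index_UNIV: "set_index UNIV = 0"
proof -
  have "set_index (set octs) = index_list octs"
    using sorted_octs by (intro index_prod_set) (simp add: strict_sorted_iff)
  also have "\<dots> = 0" by (simp only: index_list.simps index_mult_table)
  finally show ?thesis by (simp only: set_octs)
qed

lemma set_index_Un: "A \<inter> B = {} \<Longrightarrow> set_index (A \<union> B) = set_index A \<odot> set_index B"
  by (simp add: index_prod_union_disjoint)

text \<open>All eight indices multiply to 0, and every index is its own inverse.\<close>

lemma set_index_compl: "set_index (- A) = set_index A"
proof -
  have "set_index A \<odot> set_index (- A) = 0" using set_index_Un[of A "- A"] by (simp add: set_index_UNIV)
  then show ?thesis by (simp add: index_mult_eq_iff index_mult_0)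
qed

lemma card_8_2: "card B = 2 \<longleftrightarrow> (\<exists>i j. i < j \<and> B = {i, j})" for B :: "8 set"
  by (metis card_2_iff doubleton_eq_iff linorder_neqE order.strict_implies_not_eq)

lemma card_8_4E:
  assumes "card C = 4"
  obtains i0 i1 i2 i3 where "i0 < i1" "i1 < i2" "i2 < i3" "C = {i0, i1, i2, i3}"
    "set_index C = i0 \<odot> i1 \<odot> i2 \<odot> i3"
proof -
  from splits_exhaust[OF assms] obtain a where "C = set a" "sorted_wrt (<) a" "length a = 4"
    "set_index C = index_list a" by metis
  then show thesis using that
    by (elim length_4E) (auto simp: index_mult_assoc index_mult_0)
qed

lemma card_8_6E:
  fixes C :: "8 set"
  assumes "card C = 6"
  obtains i0 i1 i2 i3 i4 i5 where "i0 < i1" "i1 < i2" "i2 < i3" "i3 < i4" "i4 < i5"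
    "C = {i0, i1, i2, i3, i4, i5}"
proof -
  from splits_exhaust[OF assms] obtain a where a: "C = set a" "sorted_wrt (<) a" "length a = 6"
    by metis
  then obtain i0 i1 i2 i3 i4 i5 where "a = [i0, i1, i2, i3, i4, i5]"
    by (auto simp: length_Suc_conv numeral_eq_Suc)
  then show thesis using that a by auto
qed

lemma distinct_compl:
  fixes xs ys :: "8 list"
  assumes "distinct (xs @ ys)" "length (xs @ ys) = 8"
  shows "set ys = - set xs"
proof -
  have "card (set (xs @ ys)) = CARD(8)" using assms by (simp only: distinct_card) simp
  then have "set xs \<union> set ys = UNIV" by (metis card_subset_eq finite subset_UNIV set_append)
  then show ?thesis using assms(1) by auto
qed

lemma in_null_quads_iff: "distinct [i0, i1, i2, i3] \<Longrightarrow> {i0, i1, i2, i3} \<in> null_quads \<longleftrightarrow> i0 \<odot> i1 \<odot> i2 \<odot> i3 = 0"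
  and in_nonnull_quads_iff: "distinct [i0, i1, i2, i3] \<Longrightarrow> {i0, i1, i2, i3} \<in> nonnull_quads \<longleftrightarrow> i0 \<odot> i1 \<odot> i2 \<odot> i3 \<noteq> 0"
  by (simp_all add: null_quads_def nonnull_quads_def index_mult_assoc index_mult_0)

lemma null_quads_E:
  assumes "C \<in> null_quads"
  obtains i0 i1 i2 i3 where "i0 < i1" "i1 < i2" "i2 < i3" "C = {i0, i1, i2, i3}"
    "i0 \<odot> i1 \<odot> i2 \<odot> i3 = 0"
  using assms unfolding null_quads_def by (auto elim: card_8_4E)

lemma nonnull_quads_E:
  assumes "C \<in> nonnull_quads"
  obtains i0 i1 i2 i3 where "i0 < i1" "i1 < i2" "i2 < i3" "C = {i0, i1, i2, i3}"
    "i0 \<odot> i1 \<odot> i2 \<odot> i3 \<noteq> 0"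
  using assms unfolding nonnull_quads_def by (auto elim: card_8_4E)

section \<open>The classes in terms of index sets instead of ordered tuples\<close>

lemma class1_eq: "class1 = {(UNIV, {})}"
  by (simp only: class1_def UNIV_8)

lemma class11_eq: "class11 = {({}, UNIV)}"
  by (simp only: class11_def UNIV_8)

lemma class7_eq: "class7 = (\<lambda>C. (C, C)) ` nonnull_quads"
proof (intro equalityI subsetI)
  fix t :: "8 set \<times> 8 set" assume "t \<in> class7"
  then obtain i0 i1 i2 i3 where "t = ({i0, i1, i2, i3}, {i0, i1, i2, i3})" "i0 < i1" "i1 < i2"
    "i2 < i3" "i0 \<odot> i1 \<odot> i2 \<odot> i3 \<noteq> 0" unfolding class7_def by blast
  moreover from this have "{i0, i1, i2, i3} \<in> nonnull_quads" by (subst in_nonnull_quads_iff) auto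
  ultimately show "t \<in> (\<lambda>C. (C, C)) ` nonnull_quads" by blast
next
  fix t :: "8 set \<times> 8 set" assume "t \<in> (\<lambda>C. (C, C)) ` nonnull_quads"
  then obtain C where C: "t = (C, C)" "C \<in> nonnull_quads" by blast
  from C(2) obtain i0 i1 i2 i3 where "i0 < i1" "i1 < i2" "i2 < i3" "C = {i0, i1, i2, i3}"
    "i0 \<odot> i1 \<odot> i2 \<odot> i3 \<noteq> 0" by (rule nonnull_quads_E)
  then show "t \<in> class7" unfolding class7_def mem_Collect_eq C(1)
    by (intro exI conjI) (simp, assumption+)
qed

lemma class8_eq: "class8 = (\<lambda>C. (C, C)) ` null_quads"
proof (intro equalityI subsetI)
  fix t :: "8 set \<times> 8 set" assume "t \<in> class8"
  then obtain i0 i1 i2 i3 where "t = ({i0, i1, i2, i3}, {i0, i1, i2, i3})" "i0 < i1" "i1 < i2"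
    "i2 < i3" "i0 \<odot> i1 \<odot> i2 \<odot> i3 = 0" unfolding class8_def by blast
  moreover from this have "{i0, i1, i2, i3} \<in> null_quads" by (subst in_null_quads_iff) auto
  ultimately show "t \<in> (\<lambda>C. (C, C)) ` null_quads" by blast
next
  fix t :: "8 set \<times> 8 set" assume "t \<in> (\<lambda>C. (C, C)) ` null_quads"
  then obtain C where C: "t = (C, C)" "C \<in> null_quads" by blast
  from C(2) obtain i0 i1 i2 i3 where "i0 < i1" "i1 < i2" "i2 < i3" "C = {i0, i1, i2, i3}"
    "i0 \<odot> i1 \<odot> i2 \<odot> i3 = 0" by (rule null_quads_E)
  then show "t \<in> class8" unfolding class8_def mem_Collect_eq C(1)
    by (intro exI conjI) (simp, assumption+)
qed

lemma class4_eq: "class4 = (\<lambda>C. (C, - C)) ` null_quads"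
  and class5_eq: "class5 = (\<lambda>C. (C, - C)) ` nonnull_quads"
proof -
  have compl: "{i4, i5, i6, i7} = - {i0, i1, i2, i3}"
    if "distinct [i0,i1,i2,i3,i4,i5,i6,i7]" for i0 i1 i2 i3 i4 i5 i6 i7 :: 8
    using distinct_compl[of "[i0,i1,i2,i3]" "[i4,i5,i6,i7]"] that by simp
  \<comment> \<open>The complement of a quadruple has four elements and can therefore be listed in
    increasing order, as the classes demand.\<close>
  have ex: "\<exists>i4 i5 i6 i7. - {i0,i1,i2,i3} = {i4, i5, i6, i7} \<and> distinct [i0,i1,i2,i3,i4,i5,i6,i7] \<and>
      i4 < i5 \<and> i5 < i6 \<and> i6 < i7" if "i0 < i1" "i1 < i2" "i2 < i3" for i0 i1 i2 i3 :: 8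
  proof -
    have "distinct [i0, i1, i2, i3]" using that by auto
    then have "card {i0, i1, i2, i3} = 4" by simp
    then have "card (- {i0, i1, i2, i3}) = 4" by (simp only: card_compl_8)
    then obtain i4 i5 i6 i7 where *: "i4 < i5" "i5 < i6" "i6 < i7" "- {i0,i1,i2,i3} = {i4, i5, i6, i7}"
      by (rule card_8_4E)
    have "{i0,i1,i2,i3} \<inter> {i4,i5,i6,i7} = {}" unfolding *(4)[symmetric] by blast
    then have "distinct [i0,i1,i2,i3,i4,i5,i6,i7]" using that *(1-3) by auto
    then show ?thesis using * by blast
  qed
  show "class4 = (\<lambda>C. (C, - C)) ` null_quads"
  proof (intro equalityI subsetI)
    fix t :: "8 set \<times> 8 set" assume "t \<in> class4"
    then obtain i0 i1 i2 i3 i4 i5 i6 i7 where t: "t = ({i0,i1,i2,i3}, {i4,i5,i6,i7})"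
      "distinct [i0,i1,i2,i3,i4,i5,i6,i7]" "i0 \<odot> i1 \<odot> i2 \<odot> i3 = 0"
      unfolding class4_def by blast
    then have "{i0, i1, i2, i3} \<in> null_quads" by (subst in_null_quads_iff) auto
    then show "t \<in> (\<lambda>C. (C, - C)) ` null_quads" unfolding t(1) compl[OF t(2)] by blast
  next
    fix t :: "8 set \<times> 8 set" assume "t \<in> (\<lambda>C. (C, - C)) ` null_quads"
    then obtain C where C: "t = (C, - C)" "C \<in> null_quads" by blast
    from C(2) obtain i0 i1 i2 i3 where i: "i0 < i1" "i1 < i2" "i2 < i3" "C = {i0, i1, i2, i3}"
      "i0 \<odot> i1 \<odot> i2 \<odot> i3 = 0" by (rule null_quads_E)
    from ex[OF i(1-3)] obtain i4 i5 i6 i7 where j: "- {i0,i1,i2,i3} = {i4, i5, i6, i7}"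
      "distinct [i0,i1,i2,i3,i4,i5,i6,i7]" "i4 < i5" "i5 < i6" "i6 < i7" by blast
    show "t \<in> class4"
      unfolding class4_def mem_Collect_eq C(1) i(4) j(1) using i(1-3,5) j(2-5)
      by (intro exI conjI) (rule refl, assumption+)
  qed
  show "class5 = (\<lambda>C. (C, - C)) ` nonnull_quads"
  proof (intro equalityI subsetI)
    fix t :: "8 set \<times> 8 set" assume "t \<in> class5"
    then obtain i0 i1 i2 i3 i4 i5 i6 i7 where t: "t = ({i0,i1,i2,i3}, {i4,i5,i6,i7})"
      "distinct [i0,i1,i2,i3,i4,i5,i6,i7]" "i0 \<odot> i1 \<odot> i2 \<odot> i3 \<noteq> 0"
      unfolding class5_def by blast
    then have "{i0, i1, i2, i3} \<in> nonnull_quads" by (subst in_nonnull_quads_iff) auto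
    then show "t \<in> (\<lambda>C. (C, - C)) ` nonnull_quads" unfolding t(1) compl[OF t(2)] by blast
  next
    fix t :: "8 set \<times> 8 set" assume "t \<in> (\<lambda>C. (C, - C)) ` nonnull_quads"
    then obtain C where C: "t = (C, - C)" "C \<in> nonnull_quads" by blast
    from C(2) obtain i0 i1 i2 i3 where i: "i0 < i1" "i1 < i2" "i2 < i3" "C = {i0, i1, i2, i3}"
      "i0 \<odot> i1 \<odot> i2 \<odot> i3 \<noteq> 0" by (rule nonnull_quads_E)
    from ex[OF i(1-3)] obtain i4 i5 i6 i7 where j: "- {i0,i1,i2,i3} = {i4, i5, i6, i7}"
      "distinct [i0,i1,i2,i3,i4,i5,i6,i7]" "i4 < i5" "i5 < i6" "i6 < i7" by blast
    show "t \<in> class5"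
      unfolding class5_def mem_Collect_eq C(1) i(4) j(1) using i(1-3,5) j(2-5)
      by (intro exI conjI) (rule refl, assumption+)
  qed
qed

lemma class2_eq: "class2 = (\<lambda>B. (- B, B)) ` {B. card B = 2}"
proof (intro equalityI subsetI)
  fix t :: "8 set \<times> 8 set" assume "t \<in> class2"
  then obtain i0 i1 i2 i3 i4 i5 i6 i7 where t: "t = ({i0,i1,i2,i3,i4,i5}, {i6,i7})"
    "distinct [i0,i1,i2,i3,i4,i5,i6,i7]" "i6 < i7" unfolding class2_def by blast
  have "{i0,i1,i2,i3,i4,i5} = - {i6, i7}"
    using distinct_compl[of "[i6,i7]" "[i0,i1,i2,i3,i4,i5]"] t(2) by auto
  moreover have "card {i6, i7} = 2" using t(3) by auto
  ultimately show "t \<in> (\<lambda>B. (- B, B)) ` {B. card B = 2}" unfolding t(1) by blast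
next
  fix t :: "8 set \<times> 8 set" assume "t \<in> (\<lambda>B. (- B, B)) ` {B. card B = 2}"
  then obtain B :: "8 set" where B: "t = (- B, B)" "card B = 2" by blast
  then obtain i6 i7 where i67: "i6 < i7" "B = {i6, i7}" by (auto simp: card_8_2)
  have "card (- B) = 6" using B(2) by (simp only: card_compl_8)
  then obtain i0 i1 i2 i3 i4 i5 where *: "i0 < i1" "i1 < i2" "i2 < i3" "i3 < i4" "i4 < i5"
    "- B = {i0,i1,i2,i3,i4,i5}" by (rule card_8_6E)
  have "{i0,i1,i2,i3,i4,i5} \<inter> {i6, i7} = {}" unfolding *(6)[symmetric] i67(2)[symmetric] by blast
  then have "distinct [i0,i1,i2,i3,i4,i5,i6,i7]" using *(1-5) i67(1) by auto
  then show "t \<in> class2"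
    unfolding class2_def mem_Collect_eq B(1) *(6) unfolding i67(2) using *(1-5) i67(1)
    by (intro exI conjI) (rule refl, assumption+)
qed

lemma class10_eq: "class10 = (\<lambda>A. (A, - A)) ` {A. card A = 2}"
proof (intro equalityI subsetI)
  fix t :: "8 set \<times> 8 set" assume "t \<in> class10"
  then obtain i0 i1 i2 i3 i4 i5 i6 i7 where t: "t = ({i0,i1}, {i2,i3,i4,i5,i6,i7})"
    "distinct [i0,i1,i2,i3,i4,i5,i6,i7]" "i0 < i1" unfolding class10_def by blast
  have "{i2,i3,i4,i5,i6,i7} = - {i0, i1}"
    using distinct_compl[of "[i0,i1]" "[i2,i3,i4,i5,i6,i7]"] t(2) by auto
  moreover have "card {i0, i1} = 2" using t(3) by auto
  ultimately show "t \<in> (\<lambda>A. (A, - A)) ` {A. card A = 2}" unfolding t(1) by blast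
next
  fix t :: "8 set \<times> 8 set" assume "t \<in> (\<lambda>A. (A, - A)) ` {A. card A = 2}"
  then obtain A :: "8 set" where A: "t = (A, - A)" "card A = 2" by blast
  then obtain i0 i1 where i01: "i0 < i1" "A = {i0, i1}" by (auto simp: card_8_2)
  have "card (- A) = 6" using A(2) by (simp only: card_compl_8)
  then obtain i2 i3 i4 i5 i6 i7 where *: "i2 < i3" "i3 < i4" "i4 < i5" "i5 < i6" "i6 < i7"
    "- A = {i2,i3,i4,i5,i6,i7}" by (rule card_8_6E)
  have "{i2,i3,i4,i5,i6,i7} \<inter> {i0, i1} = {}" unfolding *(6)[symmetric] i01(2)[symmetric] by blast
  then have "distinct [i0,i1,i2,i3,i4,i5,i6,i7]" using *(1-5) i01(1) by auto
  then show "t \<in> class10"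
    unfolding class10_def mem_Collect_eq A(1) *(6) unfolding i01(2) using *(1-5) i01(1)
    by (intro exI conjI) (rule refl, assumption+)
qed

text \<open>A common parameter set for \<open>class3\<close> and \<open>class9\<close>, which differ
  only by exchanging the two kinds of coordinates.\<close>

definition null_quad_pairs :: "(8 set \<times> 8 set) set" where
  "null_quad_pairs = (SIGMA C:null_quads. {B. B \<subseteq> - C \<and> card B = 2})"

lemma null_quad_pairs_I:
  assumes "distinct [i0,i1,i2,i3,i4,i5]" "i0 \<odot> i1 \<odot> i2 \<odot> i3 = 0"
  shows "({i0,i1,i2,i3}, {i4,i5}) \<in> null_quad_pairs"
  using assms in_null_quads_iff[of i0 i1 i2 i3] by (auto simp: null_quad_pairs_def)

lemma null_quad_pairs_E:
  assumes "t \<in> null_quad_pairs"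
  obtains i0 i1 i2 i3 i4 i5 where "t = ({i0,i1,i2,i3}, {i4,i5})" "distinct [i0,i1,i2,i3,i4,i5]"
    "i0 < i1" "i1 < i2" "i2 < i3" "i4 < i5" "i0 \<odot> i1 \<odot> i2 \<odot> i3 = 0"
proof -
  obtain C B where t: "t = (C, B)" "C \<in> null_quads" "B \<subseteq> - C" "card B = 2" using assms by (auto simp: null_quad_pairs_def)
  obtain i0 i1 i2 i3 where C: "i0 < i1" "i1 < i2" "i2 < i3" "C = {i0, i1, i2, i3}"
    "i0 \<odot> i1 \<odot> i2 \<odot> i3 = 0" using t(2) by (rule null_quads_E)
  obtain i4 i5 where B: "i4 < i5" "B = {i4, i5}" using t(4) by (auto simp: card_8_2)
  have "distinct [i0,i1,i2,i3,i4,i5]" using t(3)[unfolded C(4) B(2)] C(1-3) B(1) by auto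
  then show thesis using that t(1) C B by blast
qed

lemma class3_eq: "class3 = (\<lambda>(C, B). (C \<union> B, B)) ` null_quad_pairs"
proof (intro equalityI subsetI)
  fix t :: "8 set \<times> 8 set" assume "t \<in> class3"
  then obtain i0 i1 i2 i3 i4 i5 where t: "t = ({i0,i1,i2,i3,i4,i5}, {i4,i5})"
    "distinct [i0,i1,i2,i3,i4,i5]" "i0 \<odot> i1 \<odot> i2 \<odot> i3 = 0" unfolding class3_def by blast
  then show "t \<in> (\<lambda>(C, B). (C \<union> B, B)) ` null_quad_pairs"
    by (intro image_eqI[OF _ null_quad_pairs_I[OF t(2,3)]]) auto
next
  fix t :: "8 set \<times> 8 set" assume "t \<in> (\<lambda>(C, B). (C \<union> B, B)) ` null_quad_pairs"
  then obtain i0 i1 i2 i3 i4 i5 where "t = ({i0,i1,i2,i3} \<union> {i4,i5}, {i4,i5})"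
    "distinct [i0,i1,i2,i3,i4,i5]" "i0 < i1" "i1 < i2" "i2 < i3" "i4 < i5" "i0 \<odot> i1 \<odot> i2 \<odot> i3 = 0"
    by (auto elim!: null_quad_pairs_E)
  moreover have "{i0,i1,i2,i3} \<union> {i4,i5} = {i0,i1,i2,i3,i4,i5}" by auto
  ultimately show "t \<in> class3"
    unfolding class3_def mem_Collect_eq by (intro exI conjI) (simp, assumption+)
qed

lemma class9_eq: "class9 = (\<lambda>(C, A). (A, C \<union> A)) ` null_quad_pairs"
proof (intro equalityI subsetI)
  fix t :: "8 set \<times> 8 set" assume "t \<in> class9"
  then obtain i0 i1 i2 i3 i4 i5 where t: "t = ({i0,i1}, {i0,i1,i2,i3,i4,i5})"
    "distinct [i0,i1,i2,i3,i4,i5]" "i2 \<odot> i3 \<odot> i4 \<odot> i5 = 0" unfolding class9_def by blast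
  have "distinct [i2,i3,i4,i5,i0,i1]" using t(2) by auto
  then show "t \<in> (\<lambda>(C, A). (A, C \<union> A)) ` null_quad_pairs"
    using t by (intro image_eqI[OF _ null_quad_pairs_I[of i2 i3 i4 i5 i0 i1]]) auto
next
  fix t :: "8 set \<times> 8 set" assume "t \<in> (\<lambda>(C, A). (A, C \<union> A)) ` null_quad_pairs"
  then obtain C A where CA: "t = (A, C \<union> A)" "(C, A) \<in> null_quad_pairs" by auto
  obtain i2 i3 i4 i5 i0 i1 where *: "(C, A) = ({i2,i3,i4,i5}, {i0,i1})"
    "distinct [i2,i3,i4,i5,i0,i1]" "i2 < i3" "i3 < i4" "i4 < i5" "i0 < i1" "i2 \<odot> i3 \<odot> i4 \<odot> i5 = 0"
    using CA(2) by (rule null_quad_pairs_E)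
  have "t = ({i0,i1}, {i0,i1,i2,i3,i4,i5})" using CA(1) *(1) by auto
  moreover have "distinct [i0,i1,i2,i3,i4,i5]" using *(2) by auto
  ultimately show "t \<in> class9"
    unfolding class9_def mem_Collect_eq using *(3-7) by (intro exI conjI) (assumption+)
qed

section \<open>Pairs of quadruples meeting in two indices\<close>

lemma disjoint_singletons:
  assumes "A \<inter> B = {}" "card A = card B" "set_index A = set_index B"
  shows "card A \<noteq> 1"
proof
  assume "card A = 1"
  then obtain x y where "A = {x}" "B = {y}" using assms(2) by (metis card_1_singletonE)
  then show False using assms by (simp add: index_mult_0)
qed

text \<open>If the intersection had three elements, \<open>A - B\<close> and \<open>B - A\<close>
  would be disjoint singletons with equal index product; if it had one, the same would hold for
  \<open>A \<inter> B\<close> and the complement of the union. Sizes 4 and 0 mean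
  \<open>B = A\<close> and \<open>B = - A\<close>.\<close>

lemma card_Int_2:
  assumes "card A = 4" "card B = 4" "set_index A = set_index B" "B \<noteq> A" "B \<noteq> - A"
  shows "card (A \<inter> B) = 2"
proof -
  let ?c = "card (A \<inter> B)"
  have split: "card X = card (X \<inter> Y) + card (X - Y)" "set_index X = set_index (X \<inter> Y) \<odot> set_index (X - Y)" for X Y :: "8 set"
  proof -
    have "X \<inter> Y \<inter> (X - Y) = {}" by blast
    from card_Un_disjoint[OF _ _ this] set_index_Un[OF this]
    show "card X = card (X \<inter> Y) + card (X - Y)" "set_index X = set_index (X \<inter> Y) \<odot> set_index (X - Y)"
      by (simp_all only: Int_Diff_Un finite)
  qed
  have diff: "card (A - B) = 4 - ?c" "card (B - A) = 4 - ?c"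
    using split(1)[of A B] split(1)[of B A] assms(1,2) by (simp_all add: Int_commute)
  have "card (- A) = 4" "card (- B) = 4" using assms(1,2) by (simp_all only: card_compl_8)
  have "- B \<inter> A = A - B" "- B - A = - A - B" by auto
  then have compl: "card (- A - B) = ?c"
    using split(1)[of "- B" A] \<open>card (- B) = 4\<close> diff(1) card_mono[of A "A \<inter> B"] assms(1) by simp
  have "set_index (A - B) = set_index (B - A)"
    using split(2)[of A B] split(2)[of B A] assms(3) index_mult_cancel by (metis Int_commute)
  then have "4 - ?c \<noteq> 1"
    using disjoint_singletons[of "A - B" "B - A"] diff by auto
  have "set_index (A \<inter> B) = set_index (- A - B)"
    using split(2)[of A B] split(2)[of "- B" A] set_index_compl[of B] assms(3) index_mult_cancel
    by (metis Int_commute \<open>- B \<inter> A = A - B\<close> \<open>- B - A = - A - B\<close> index_mult_commute)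
  then have "?c \<noteq> 1"
    using disjoint_singletons[of "A \<inter> B" "- A - B"] compl by auto
  have "?c \<noteq> 4"
    using assms(1,2,4) by (metis Int_lower1 Int_lower2 card_subset_eq finite)
  have "?c \<noteq> 0"
  proof
    assume "?c = 0"
    then have "B \<subseteq> - A" by auto
    then show False using assms(2,5) \<open>card (- A) = 4\<close> by (metis card_subset_eq finite)
  qed
  moreover have "?c \<le> 4" using card_mono[of A "A \<inter> B"] assms(1) by simp
  ultimately show ?thesis
    using \<open>4 - ?c \<noteq> 1\<close> \<open>?c \<noteq> 1\<close> \<open>?c \<noteq> 4\<close> by linarith
qed

lemma index_mult_eq_0_iff: "i \<odot> j = 0 \<longleftrightarrow> i = j"
  using index_mult_eq_iff[of i j 0] by (auto simp: index_mult_0)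

text \<open>Multiplied by \<open>i1\<close> the element gives the full product; multiplied by any of
  the other three it gives a product of two distinct indices. None of these is 0.\<close>

lemma fano_notin:
  assumes "distinct [i0, i1, i2, i3]" "i0 \<odot> i1 \<odot> i2 \<odot> i3 \<noteq> 0"
  shows "i0 \<odot> i2 \<odot> i3 \<notin> {i0, i1, i2, i3}"
proof -
  have "(i0 \<odot> i2 \<odot> i3) \<odot> i0 \<noteq> 0" "(i0 \<odot> i2 \<odot> i3) \<odot> i1 \<noteq> 0"
    "(i0 \<odot> i2 \<odot> i3) \<odot> i2 \<noteq> 0" "(i0 \<odot> i2 \<odot> i3) \<odot> i3 \<noteq> 0"
    using assms by (simp_all add: index_mult_simps index_mult_eq_0_iff)
  then show ?thesis unfolding index_mult_eq_0_iff by blast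
qed

text \<open>Otherwise the element would be one of the two points outside the union. As their product
  is \<open>i2 \<odot> i3\<close>, the other point would be \<open>i0\<close>, which lies in the
  quadruple.\<close>

lemma fano_points:
  assumes "distinct [i0, i1, i2, i3]" "i0 \<odot> i1 \<odot> i2 \<odot> i3 \<noteq> 0"
    and "card (- ({i0, i1, i2, i3} \<union> E)) = 2" "set_index (- ({i0, i1, i2, i3} \<union> E)) = i2 \<odot> i3"
  shows "i0 \<odot> i2 \<odot> i3 \<in> E"
proof (rule ccontr)
  let ?x = "i0 \<odot> i2 \<odot> i3" and ?A = "{i0, i1, i2, i3}"
  assume "?x \<notin> E"
  then have "?x \<in> - (?A \<union> E)" using fano_notin[OF assms(1,2)] by blast
  moreover obtain a b where ab: "- (?A \<union> E) = {a, b}" "a \<noteq> b"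
    using assms(3) unfolding card_2_iff by blast
  ultimately have "?x = a \<or> ?x = b" by blast
  then obtain v where O: "- (?A \<union> E) = {?x, v}" "?x \<noteq> v"
  proof (elim disjE)
    assume "?x = a"
    with ab show thesis by (intro that[of b]) simp_all
  next
    assume "?x = b"
    with ab show thesis by (intro that[of a]) (simp_all add: insert_commute)
  qed
  then have "?x \<odot> v = i2 \<odot> i3" using assms(4) by (simp add: index_mult_0)
  then have "v = i0" unfolding index_mult_eq_iff by (simp add: index_mult_simps)
  then have "i0 \<in> - (?A \<union> E)" using O(1) by blast
  then show False by blast
qed

text \<open>The formulas for \<open>i4\<close> and \<open>i5\<close> are forced: with
  \<open>i2\<close>, \<open>i3\<close> spanning the intersection and \<open>i0\<close>,
  \<open>i1\<close> the rest of \<open>A\<close>, equality of the index products determines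
  \<open>B - A\<close>.\<close>

lemma class6_eq: "class6 = {(A, B). A \<in> nonnull_quads \<and> card B = 4 \<and> set_index B = set_index A \<and> B \<noteq> A \<and> B \<noteq> - A}"
proof (intro equalityI subsetI)
  fix t :: "8 set \<times> 8 set" assume "t \<in> class6"
  then obtain i0 i1 i2 i3 i4 i5 where t: "t = ({i0,i1,i2,i3}, {i2,i3,i4,i5})"
    "distinct [i0,i1,i2,i3,i4,i5]" "i0 \<odot> i1 \<odot> i2 \<odot> i3 \<noteq> 0" "i4 = i0 \<odot> i2 \<odot> i3" "i5 = i1 \<odot> i2 \<odot> i3"
    unfolding class6_def by blast
  have "{i0, i1, i2, i3} \<in> nonnull_quads" using t(2,3) by (subst in_nonnull_quads_iff) auto
  moreover have "card {i2, i3, i4, i5} = 4" using t(2) by simp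
  moreover have "set_index {i2, i3, i4, i5} = set_index {i0, i1, i2, i3}"
  proof -
    have "set_index {i2, i3, i4, i5} = i2 \<odot> (i3 \<odot> (i4 \<odot> i5))" "set_index {i0, i1, i2, i3} = i0 \<odot> (i1 \<odot> (i2 \<odot> i3))"
      using t(2) by (simp_all add: index_mult_0)
    then show ?thesis by (simp only: t(4,5) index_mult_simps)
  qed
  moreover have "{i2, i3, i4, i5} \<noteq> {i0, i1, i2, i3}" using t(2) by auto
  moreover have "{i2, i3, i4, i5} \<noteq> - {i0, i1, i2, i3}" by blast
  ultimately show "t \<in> {(A, B). A \<in> nonnull_quads \<and> card B = 4 \<and> set_index B = set_index A \<and> B \<noteq> A \<and> B \<noteq> - A}"
    unfolding t(1) mem_Collect_eq prod.case by (intro conjI)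
next
  fix t :: "8 set \<times> 8 set" assume t': "t \<in> {(A, B). A \<in> nonnull_quads \<and> card B = 4 \<and> set_index B = set_index A \<and> B \<noteq> A \<and> B \<noteq> - A}"
  obtain A B where AB: "t = (A, B)" by (cases t)
  have t: "t = (A, B)" "card A = 4" "set_index A \<noteq> 0" "card B = 4" "set_index A = set_index B" "B \<noteq> A" "B \<noteq> - A"
    using t' unfolding AB nonnull_quads_def mem_Collect_eq prod.case by (elim conjE, simp only:)+
  have I: "card (A \<inter> B) = 2" using t(2,4-7) by (rule card_Int_2)
  then obtain i2 i3 where i23: "i2 < i3" "A \<inter> B = {i2, i3}" by (auto simp: card_8_2)
  have "card (A - B) = 2" "card (B - A) = 2"
    using I t(2,4) by (simp_all add: card_Diff_subset_Int Int_commute)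
  then obtain i0 i1 where i01: "i0 < i1" "A - B = {i0, i1}" by (auto simp: card_8_2)
  have A: "A = {i0, i1, i2, i3}" using i01(2) i23(2) by blast
  have dist: "distinct [i0, i1, i2, i3]" using i01 i23 by auto
  then have PA: "set_index A = i0 \<odot> i1 \<odot> i2 \<odot> i3"
    unfolding A by (simp add: index_mult_assoc index_mult_0)
  have "card (A \<union> B) = 6"
    using card_Un_disjoint[of A "B - A"] t(2) \<open>card (B - A) = 2\<close> by simp
  then have O: "card (- (A \<union> B)) = 2" by (simp only: card_compl_8)
  have "A \<inter> B \<union> (B - A) = B" "(A \<inter> B) \<inter> (B - A) = {}" by auto
  then have "set_index B = set_index (A \<inter> B) \<odot> set_index (B - A)" using set_index_Un[of "A \<inter> B" "B - A"] by simp
  moreover have "set_index (A \<union> B) = set_index A \<odot> set_index (B - A)" using set_index_Un[of A "B - A"] by simp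
  \<comment> \<open>Since \<open>A\<close> and \<open>B\<close> have equal index product, the factor
    of \<open>B - A\<close> occurs twice and cancels.\<close>
  ultimately have "set_index (A \<union> B) = set_index (A \<inter> B)"
    by (simp add: t(5) index_mult_assoc index_mult_self index_mult_0)
  then have PO: "set_index (- (A \<union> B)) = i2 \<odot> i3"
    unfolding set_index_compl i23(2) using i23(1) by (simp add: index_mult_0)
  let ?x = "i0 \<odot> i2 \<odot> i3" and ?y = "i1 \<odot> i2 \<odot> i3"
  \<comment> \<open>The hypotheses are symmetric in \<open>i0\<close> and \<open>i1\<close>, so
    exchanging them yields the statements about \<open>?y\<close>.\<close>
  have dist': "distinct [i1, i0, i2, i3]" using dist by auto
  have A': "A = {i1, i0, i2, i3}" unfolding A by blast
  have nz: "i0 \<odot> i1 \<odot> i2 \<odot> i3 \<noteq> 0" using t(3) unfolding PA .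
  have "?x \<in> B"
    using fano_points[OF dist nz, of B] O PO unfolding A by blast
  moreover have swap: "i1 \<odot> i0 \<odot> i2 \<odot> i3 \<noteq> 0"
    using nz by (simp only: index_mult_commute[of i1 i0] not_False_eq_True)
  then have "?y \<in> B"
    using fano_points[OF dist', of B] O PO unfolding A' by blast
  moreover have neq: "?x \<noteq> ?y"
  proof
    assume "?x = ?y"
    then have "(i2 \<odot> i3) \<odot> ((i2 \<odot> i3) \<odot> i0) = (i2 \<odot> i3) \<odot> ((i2 \<odot> i3) \<odot> i1)"
      by (simp only: index_mult_simps)
    then show False using dist unfolding index_mult_cancel by simp
  qed
  moreover have xA: "?x \<notin> A"
    using fano_notin[OF dist nz] unfolding A .
  moreover have yA: "?y \<notin> A"
    using fano_notin[OF dist' swap] unfolding A' .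
  ultimately have "{?x, ?y} \<subseteq> B - A" "card {?x, ?y} = 2" by auto
  then have E: "B - A = {?x, ?y}"
    using \<open>card (B - A) = 2\<close> by (metis card_subset_eq finite)
  then have B: "B = {i2, i3, ?x, ?y}" using i23(2) by blast
  have "distinct [i0, i1, i2, i3, ?x, ?y]"
    using dist xA yA neq unfolding A by (auto simp only: distinct.simps list.set)
  with nz show "t \<in> class6"
    unfolding class6_def mem_Collect_eq t(1) B unfolding A using i01(1) i23(1)
    by (intro exI conjI) (rule refl, assumption+, rule refl, rule refl)
qed

text \<open>The count runs over the 70 splits of the index list; as a check, 14 + 7 * 8 =
  70.\<close>

lemma card_quads_index: "card {C. card C = 4 \<and> set_index C = k} = (if k = 0 then 14 else 8)"
proof -
  have "{C. card C = 4 \<and> set_index C = k} = {C. C \<subseteq> set octs \<and> card C = 4} \<inter> {C. set_index C = k}"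
    unfolding set_octs by auto
  then have "card {C. card C = 4 \<and> set_index C = k} =
      (\<Sum>C | C \<subseteq> set octs \<and> card C = 4. of_bool (set_index C = k))"
    by (simp add: sum_of_bool_eq del: list.set)
  also have "\<dots> = (\<Sum>(s, a, a')\<leftarrow>splits 4 octs. of_bool (set_index (set a) = k))"
    using sorted_octs by (intro sum_splits) (simp add: strict_sorted_iff)
  also have "\<dots> = (\<Sum>(s, a, a')\<leftarrow>splits 4 octs. of_bool (index_list a = k))"
  proof (intro sum_list_cong, clarify)
    fix s a a' assume "(s, a, a') \<in> set (splits 4 octs)"
    from set_splits[OF this sorted_octs]
    show "of_bool (set_index (set a) = k) = (of_bool (index_list a = k) :: nat)"
      by (simp add: index_prod_set strict_sorted_iff)
  qed
  also have "\<dots> = (if k = 0 then 14 else 8)"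
  proof -
    have "\<forall>k. (\<Sum>(s, a, a')\<leftarrow>splits 4 octs. of_bool (index_list a = k)) = (if k = 0 then 14 else 8 :: nat)"
      by (simp only: splits_eval, simp only: forall_8 signs_eval of_bool_eq)
    then show ?thesis by blast
  qed
  finally show ?thesis .
qed

lemma card_8_choose: "card {B :: 8 set. card B = k} = 8 choose k"
  using n_subsets[of "UNIV :: 8 set" k] by simp

lemma card_null_quads: "card null_quads = 14"
  unfolding null_quads_def card_quads_index by simp

lemma card_nonnull_quads: "card nonnull_quads = 56"
proof -
  have sub: "null_quads \<subseteq> {C. card C = 4}" by (auto simp: null_quads_def)
  have "nonnull_quads = {C. card C = 4} - null_quads" by (auto simp: nonnull_quads_def null_quads_def)
  then have "card nonnull_quads = card {C :: 8 set. card C = 4} - card null_quads"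
    using card_Diff_subset[OF finite sub] by (simp only:)
  also have "\<dots> = (8 choose 4) - 14" by (simp only: card_null_quads card_8_choose)
  also have "\<dots> = 56" by (simp add: numeral_eq_Suc)
  finally show ?thesis .
qed

lemma card_null_quad_pairs: "card null_quad_pairs = 84"
proof -
  have "card {B. B \<subseteq> - C \<and> card B = 2} = 6" if "C \<in> null_quads" for C
    using n_subsets[of "- C" 2] that by (simp add: null_quads_def card_compl_8 choose_two)
  then show ?thesis by (simp add: null_quad_pairs_def card_null_quads)
qed

lemma card_classes:
  "card class1 = 1" "card class2 = 28" "card class3 = 84" "card class4 = 14" "card class5 = 56"
  "card class6 = 336" "card class7 = 56" "card class8 = 14" "card class9 = 84" "card class10 = 28"
  "card class11 = 1"
proof -
  have two: "card {B :: 8 set. card B = 2} = 28" by (simp add: card_8_choose choose_two)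
  show "card class1 = 1" "card class11 = 1" by (simp_all add: class1_eq class11_eq)
  show "card class2 = 28" "card class10 = 28"
    unfolding class2_eq class10_eq by (subst card_image; simp add: inj_on_def two)+
  show "card class4 = 14" "card class8 = 14"
    unfolding class4_eq class8_eq by (subst card_image; simp add: inj_on_def card_null_quads)+
  show c57: "card class5 = 56" "card class7 = 56"
    unfolding class5_eq class7_eq by (subst card_image; simp add: inj_on_def card_nonnull_quads)+
  have "inj_on (\<lambda>(C, B). (C \<union> B, B)) null_quad_pairs" "inj_on (\<lambda>(C, A). (A, C \<union> A)) null_quad_pairs"
    by (auto simp: inj_on_def null_quad_pairs_def)
  then show "card class3 = 84" "card class9 = 84"
    unfolding class3_eq class9_eq by (simp_all add: card_image card_null_quad_pairs)
  \<comment> \<open>Each of the 56 quadruples has 8 partners with the same index product. Removing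
    the partners \<open>A\<close> and \<open>- A\<close> leaves 56 * 8 - 112 = 336 pairs.\<close>
  let ?S = "SIGMA A:nonnull_quads. {B. card B = 4 \<and> set_index B = set_index A}"
  have "card {B. card B = 4 \<and> set_index B = set_index A} = 8" if "A \<in> nonnull_quads" for A
    using that by (simp add: card_quads_index nonnull_quads_def)
  then have S: "card ?S = 448" by (simp add: card_nonnull_quads)
  have "class6 = ?S - (class5 \<union> class7)"
    unfolding class5_eq class6_eq class7_eq by auto
  moreover have sub: "class5 \<union> class7 \<subseteq> ?S"
    unfolding class5_eq class7_eq by (auto simp: nonnull_quads_def card_compl_8 set_index_compl)
  moreover have "card (class5 \<union> class7) = 112"
  proof -
    have "class5 \<inter> class7 = {}" unfolding class5_eq class7_eq by auto
    then show ?thesis using c57 by (simp add: card_Un_disjoint)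
  qed
  ultimately show "card class6 = 336"
    using card_Diff_subset[OF finite sub] S by simp
qed

text \<open>The last entry is set to \<open>False\<close> outside \<open>card A = 4\<close>, so that
  no index product has to be computed for the remaining classes.\<close>

definition class_key :: "8 set \<times> 8 set \<Rightarrow> nat \<times> nat \<times> bool" where
  "class_key = (\<lambda>(A, B). (card A, card (A \<inter> B), card A = 4 \<and> set_index A = 0))"

lemma class_key:
  "t \<in> class1 \<Longrightarrow> class_key t = (8, 0, False)"
  "t \<in> class2 \<Longrightarrow> class_key t = (6, 0, False)"
  "t \<in> class3 \<Longrightarrow> class_key t = (6, 2, False)"
  "t \<in> class4 \<Longrightarrow> class_key t = (4, 0, True)"
  "t \<in> class5 \<Longrightarrow> class_key t = (4, 0, False)"
  "t \<in> class6 \<Longrightarrow> class_key t = (4, 2, False)"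
  "t \<in> class7 \<Longrightarrow> class_key t = (4, 4, False)"
  "t \<in> class8 \<Longrightarrow> class_key t = (4, 4, True)"
  "t \<in> class9 \<Longrightarrow> class_key t = (2, 2, False)"
  "t \<in> class10 \<Longrightarrow> class_key t = (2, 0, False)"
  "t \<in> class11 \<Longrightarrow> class_key t = (0, 0, False)"
proof -
  have null_quad_pairs: "card C = 4 \<and> card B = 2 \<and> C \<inter> B = {}" if "(C, B) \<in> null_quad_pairs" for C B
    using that by (auto simp: null_quad_pairs_def null_quads_def)
  show "t \<in> class3 \<Longrightarrow> class_key t = (6, 2, False)" "t \<in> class9 \<Longrightarrow> class_key t = (2, 2, False)"
    unfolding class3_eq class9_eq
    by (auto simp: class_key_def card_Un_disjoint Int_absorb1 Int_absorb2 dest!: null_quad_pairs)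
  show "t \<in> class6 \<Longrightarrow> class_key t = (4, 2, False)"
    by (cases t) (simp add: class6_eq class_key_def nonnull_quads_def card_Int_2)
qed (auto simp: class_key_def class1_eq class2_eq class4_eq class5_eq class7_eq class8_eq class10_eq
    class11_eq nonnull_quads_def null_quads_def card_compl_8)

lemma Psi8_coeff_class:
  "t \<in> class1 \<Longrightarrow> Psi8_coeff t = - 14"
  "t \<in> class2 \<Longrightarrow> \<bar>Psi8_coeff t\<bar> = 2"
  "t \<in> class3 \<Longrightarrow> \<bar>Psi8_coeff t\<bar> = 2"
  "t \<in> class4 \<Longrightarrow> \<bar>Psi8_coeff t\<bar> = 2"
  "t \<in> class5 \<Longrightarrow> \<bar>Psi8_coeff t\<bar> = 1"
  "t \<in> class6 \<Longrightarrow> \<bar>Psi8_coeff t\<bar> = 1"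
  "t \<in> class7 \<Longrightarrow> \<bar>Psi8_coeff t\<bar> = 1"
  "t \<in> class8 \<Longrightarrow> \<bar>Psi8_coeff t\<bar> = 2"
  "t \<in> class9 \<Longrightarrow> \<bar>Psi8_coeff t\<bar> = 2"
  "t \<in> class10 \<Longrightarrow> \<bar>Psi8_coeff t\<bar> = 2"
  "t \<in> class11 \<Longrightarrow> Psi8_coeff t = - 14"
proof -
  have null_quad_pairs: "card (C \<union> B) = 6 \<and> card B = 2 \<and> set_index (C \<union> B) = set_index B" if "(C, B) \<in> null_quad_pairs" for C B
  proof -
    have "card C = 4" "card B = 2" "set_index C = 0" "C \<inter> B = {}" using that by (auto simp: null_quad_pairs_def null_quads_def)
    then show ?thesis by (simp add: card_Un_disjoint set_index_Un index_mult_0)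
  qed
  show "t \<in> class3 \<Longrightarrow> \<bar>Psi8_coeff t\<bar> = 2" "t \<in> class9 \<Longrightarrow> \<bar>Psi8_coeff t\<bar> = 2"
    unfolding class3_eq class9_eq by (auto dest!: null_quad_pairs simp: Psi8_coeff_6_2)
  show "t \<in> class6 \<Longrightarrow> \<bar>Psi8_coeff t\<bar> = 1"
    by (cases t) (simp add: class6_eq nonnull_quads_def Psi8_coeff_4_4)
qed (auto simp: class1_eq class2_eq class4_eq class5_eq class7_eq class8_eq class10_eq
    class11_eq nonnull_quads_def null_quads_def Psi8_coeff_8_0 Psi8_coeff_6_2 Psi8_coeff_4_4 card_compl_8 set_index_compl)

text \<open>If \<open>B\<close> lies in \<open>A\<close>, cancellation gives \<open>A - B\<close>
  the index product 0. Otherwise \<open>B\<close> and \<open>- A\<close> are pairs with equal index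
  product and a common element, hence equal.\<close>

lemma pairs_6_2:
  assumes "card A = 6" "card B = 2" "set_index A = set_index B"
  shows "(A, B) \<in> class2 \<union> class3" "(B, A) \<in> class9 \<union> class10"
proof -
  have "B = - A \<or> (A - B, B) \<in> null_quad_pairs \<and> B \<subseteq> A"
  proof (cases "B \<inter> - A = {}")
    case True
    then have sub: "B \<subseteq> A" by auto
    then have "card (A - B) = 4" using assms by (simp add: card_Diff_subset)
    moreover have "(A - B) \<inter> B = {}" by blast
    from set_index_Un[OF this] have "set_index (A - B) \<odot> set_index B = set_index A"
      using sub by (simp add: Un_absorb2)
    then have "set_index (A - B) = 0"
      using assms(3) index_mult_eq_iff[of "set_index B" "set_index (A - B)" "set_index B"]
      by (simp add: index_mult_commute index_mult_self)
    ultimately show ?thesis using sub assms(2) by (auto simp: null_quad_pairs_def null_quads_def)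
  next
    case False
    then obtain x where x: "x \<in> B" "x \<in> - A" by blast
    have "card (- A) = 2" using assms(1) by (simp only: card_compl_8)
    with x assms(2) have one: "card (B - {x}) = 1" "card (- A - {x}) = 1" by simp_all
    obtain y where y: "B - {x} = {y}" using one(1) by (rule card_1_singletonE)
    obtain z where z: "- A - {x} = {z}" using one(2) by (rule card_1_singletonE)
    have B: "B = {x, y}" "x \<noteq> y" and A: "- A = {x, z}" "x \<noteq> z" using x y z by blast+
    have "x \<odot> y = x \<odot> z"
      using assms(3) set_index_compl[of A] B A by (simp add: index_mult_0)
    then have "y = z" unfolding index_mult_eq_iff index_mult_cancel .
    then show ?thesis using A B by simp
  qed
  then have "(A, B) \<in> class2 \<union> class3 \<and> (B, A) \<in> class9 \<union> class10"
  proof (elim disjE conjE)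
    assume "B = - A"
    then have "(A, B) = (- B, B)" "(B, A) = (B, - B)" by auto
    then show ?thesis unfolding class2_eq class10_eq using assms(2) by blast
  next
    assume null_quad_pairs: "(A - B, B) \<in> null_quad_pairs" and "B \<subseteq> A"
    then have "(A, B) = (\<lambda>(C, B). (C \<union> B, B)) (A - B, B)" "(B, A) = (\<lambda>(C, A). (A, C \<union> A)) (A - B, B)"
      by auto
    then show ?thesis unfolding class3_eq class9_eq using null_quad_pairs by blast
  qed
  then show "(A, B) \<in> class2 \<union> class3" "(B, A) \<in> class9 \<union> class10" by blast+
qed

lemma Psi8_coeff_nonzero:
  assumes "Psi8_coeff (A, B) \<noteq> 0"
  shows "(A, B) \<in> class1 \<union> class2 \<union> class3 \<union> class4 \<union> class5 \<union> class6 \<union> class7 \<union> class8 \<union>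
    class9 \<union> class10 \<union> class11"
proof -
  have PAB: "set_index A = set_index B" using assms Psi8_coeff_ungraded by blast
  have "(card A, card B) \<in> {(8, 0), (6, 2), (4, 4), (2, 6), (0, 8)}"
    by (rule ccontr) (use assms Psi8_coeff_bidegree in simp)
  then consider "card A = 8" "card B = 0" | "card A = 6" "card B = 2" | "card A = 4" "card B = 4"
    | "card A = 2" "card B = 6" | "card A = 0" "card B = 8"
    unfolding insert_iff prod.inject empty_iff by (elim disjE conjE) (simp_all del: card_0_eq)
  then show ?thesis
  proof cases
    case 1
    then have "A = UNIV" "B = {}" using card_eq_UNIV_imp_eq_UNIV[of A] by auto
    then show ?thesis by (simp add: class1_eq)
  next
    case 2
    then show ?thesis using pairs_6_2(1)[of A B] PAB by blast
  next
    case 3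
    have "(A, B) \<in> class4 \<union> class5 \<union> class6 \<union> class7 \<union> class8"
    proof (cases "set_index A = 0")
      case True
      \<comment> \<open>For every other pair of null quadruples the 16 summands cancel, which is why
        \<open>class6\<close> has no counterpart with vanishing index product.\<close>
      then have "B = A \<or> B = - A"
        using Psi8_coeff_4_4[OF 3 PAB] assms by (simp split: if_splits)
      moreover have "A \<in> null_quads" using True 3 by (simp add: null_quads_def)
      ultimately show ?thesis unfolding class4_eq class8_eq by blast
    next
      case False
      then have "A \<in> nonnull_quads" using 3 by (simp add: nonnull_quads_def)
      then show ?thesis using 3 PAB unfolding class5_eq class6_eq class7_eq by auto
    qed
    then show ?thesis by blast
  next
    case 4
    then show ?thesis using pairs_6_2(2)[of B A] PAB by auto
  next
    case 5
    then have "A = {}" "B = UNIV" using card_eq_UNIV_imp_eq_UNIV[of B] by auto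
    then show ?thesis by (simp add: class11_eq)
  qed
qed

theorem mainTheorem3:
  shows "\<exists>c :: 8 set \<times> 8 set \<Rightarrow> real.
    (- 1 / (4 * fact 6)) *\<^sub>R Psi8 = real_form (\<Sum>t\<in>UNIV. c t *\<^sub>R monomial t) \<and>
    card {t. c t \<noteq> 0} = 702 \<and>
    {t. c t \<noteq> 0} = class1 \<union> class2 \<union> class3 \<union> class4 \<union> class5 \<union> class6 \<union>
                     class7 \<union> class8 \<union> class9 \<union> class10 \<union> class11 \<and>
    card class1 = 1 \<and> (\<forall>t\<in>class1. c t = -14) \<and>
    card class2 = 28 \<and> (\<forall>t\<in>class2. c t = 2 \<or> c t = -2) \<and>
    card class3 = 84 \<and> (\<forall>t\<in>class3. c t = 2 \<or> c t = -2) \<and>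
    card class4 = 14 \<and> (\<forall>t\<in>class4. c t = 2 \<or> c t = -2) \<and>
    card class5 = 56 \<and> (\<forall>t\<in>class5. c t = 1 \<or> c t = -1) \<and>
    card class6 = 336 \<and> (\<forall>t\<in>class6. c t = 1 \<or> c t = -1) \<and>
    card class7 = 56 \<and> (\<forall>t\<in>class7. c t = 1 \<or> c t = -1) \<and>
    card class8 = 14 \<and> (\<forall>t\<in>class8. c t = 2 \<or> c t = -2) \<and>
    card class9 = 84 \<and> (\<forall>t\<in>class9. c t = 2 \<or> c t = -2) \<and>
    card class10 = 28 \<and> (\<forall>t\<in>class10. c t = 2 \<or> c t = -2) \<and>
    card class11 = 1 \<and> (\<forall>t\<in>class11. c t = -14)"
proof -
  let ?U = "class1 \<union> class2 \<union> class3 \<union> class4 \<union> class5 \<union> class6 \<union>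
    class7 \<union> class8 \<union> class9 \<union> class10 \<union> class11"
  have abs_cases: "\<bar>r\<bar> = 1 \<longleftrightarrow> r = 1 \<or> r = - 1" "\<bar>r\<bar> = 2 \<longleftrightarrow> r = 2 \<or> r = - 2" for r :: real
    by linarith+
  have vals: "\<forall>t\<in>class1. Psi8_coeff t = -14"
    "\<forall>t\<in>class2. Psi8_coeff t = 2 \<or> Psi8_coeff t = -2"
    "\<forall>t\<in>class3. Psi8_coeff t = 2 \<or> Psi8_coeff t = -2"
    "\<forall>t\<in>class4. Psi8_coeff t = 2 \<or> Psi8_coeff t = -2"
    "\<forall>t\<in>class5. Psi8_coeff t = 1 \<or> Psi8_coeff t = -1"
    "\<forall>t\<in>class6. Psi8_coeff t = 1 \<or> Psi8_coeff t = -1"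
    "\<forall>t\<in>class7. Psi8_coeff t = 1 \<or> Psi8_coeff t = -1"
    "\<forall>t\<in>class8. Psi8_coeff t = 2 \<or> Psi8_coeff t = -2"
    "\<forall>t\<in>class9. Psi8_coeff t = 2 \<or> Psi8_coeff t = -2"
    "\<forall>t\<in>class10. Psi8_coeff t = 2 \<or> Psi8_coeff t = -2"
    "\<forall>t\<in>class11. Psi8_coeff t = -14"
    using Psi8_coeff_class unfolding abs_cases by blast+
  have "Psi8_coeff t \<noteq> 0" if "t \<in> ?U" for t
    using that by (elim UnE) (use Psi8_coeff_class[of t] in force)+
  moreover have "t \<in> ?U" if "Psi8_coeff t \<noteq> 0" for t
    using Psi8_coeff_nonzero[of "fst t" "snd t"] that by simp
  ultimately have support: "{t. Psi8_coeff t \<noteq> 0} = ?U" by blast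
  \<comment> \<open>Each class against the union of its predecessors, matching the left-nested union
    that \<open>card_Un_disjoint\<close> takes apart.\<close>
  have disjoint:
    "class1 \<inter> class2 = {}"
    "(class1 \<union> class2) \<inter> class3 = {}"
    "(class1 \<union> class2 \<union> class3) \<inter> class4 = {}"
    "(class1 \<union> class2 \<union> class3 \<union> class4) \<inter> class5 = {}"
    "(class1 \<union> class2 \<union> class3 \<union> class4 \<union> class5) \<inter> class6 = {}"
    "(class1 \<union> class2 \<union> class3 \<union> class4 \<union> class5 \<union> class6)
      \<inter> class7 = {}"
    "(class1 \<union> class2 \<union> class3 \<union> class4 \<union> class5 \<union> class6
      \<union> class7) \<inter> class8 = {}"
    "(class1 \<union> class2 \<union> class3 \<union> class4 \<union> class5 \<union> class6
      \<union> class7 \<union> class8) \<inter> class9 = {}"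
    "(class1 \<union> class2 \<union> class3 \<union> class4 \<union> class5 \<union> class6
      \<union> class7 \<union> class8 \<union> class9) \<inter> class10 = {}"
    "(class1 \<union> class2 \<union> class3 \<union> class4 \<union> class5 \<union> class6
      \<union> class7 \<union> class8 \<union> class9 \<union> class10) \<inter> class11 = {}"
    by (auto dest!: class_key)
  have "card {t. Psi8_coeff t \<noteq> 0} = 702"
    unfolding support by (simp add: card_Un_disjoint disjoint card_classes)
  then show ?thesis
    by (intro exI[of _ Psi8_coeff] conjI Psi8_expansion support vals card_classes)
qed

end
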